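(* Let $R$ be a Noetherian local ring of characteristic $p>0$ and let $I$ be an ideal generated by a system of parameters of $R$. Then $*\text{-}\operatorname{core}(I)=\operatorname{core}(I)$.
   Context: A reduction of $I$ is an ideal $J\subset I$ with $JI^n=I^{n+1}$ for some $n\ge0$; $\operatorname{core}(I)$ is the intersection of all reductions of $I$. Tight closure: $x\in I^*$ iff there is $c\in R^0$ (the elements outside all minimal primes) with $cx^q\in I^{[q]}$ for all large powers $q$ of $p$, where $I^{[q]}$ is generated by the $q$-th powers of elements of $I$. A $*$-reduction of $I$ is an ideal $J$ with $J\subset I\subset J^*$; $*\text{-}\operatorname{core}(I)$ is the intersection of all $*$-reductions of $I$. *)

theory Defs
  imports
    "HOL-Library.Extended_Nat"
    "HOL-Computational_Algebra.Primes"
    "HOL-Algebra.Ring_Divisibility"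
    "HOL-Algebra.Ideal_Product"
    "HOL-Algebra.Multiplicative_Group"
begin

locale local_ring = cring +
  assumes ex1_maximalideal: "\<exists>!M. maximalideal M R"

text \<open>Meaningful only when the maximal ideal is unique.\<close>

definition max_ideal :: "('a, 'b) ring_scheme \<Rightarrow> 'a set" where
  "max_ideal R = (THE M. maximalideal M R)"

text \<open>The additive order of the unit; \<open>group.ord\<close> is 0 for elements of infinite order.\<close>

definition ring_characteristic :: "('a, 'b) ring_scheme \<Rightarrow> nat" where
  "ring_characteristic R = group.ord (add_monoid R) \<one>\<^bsub>R\<^esub>"

definition krull_dim :: "('a, 'b) ring_scheme \<Rightarrow> enat" where
  "krull_dim R =
     (SUP n \<in> {n. \<exists>P :: nat \<Rightarrow> 'a set.
                 (\<forall>i\<le>n. primeideal (P i) R) \<and> (\<forall>i<n. P i \<subset> P (Suc i))}. enat n)"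

definition ideal_radical :: "('a, 'b) ring_scheme \<Rightarrow> 'a set \<Rightarrow> 'a set" where
  "ideal_radical R I = {x \<in> carrier R. \<exists>n :: nat. x [^]\<^bsub>R\<^esub> n \<in> I}"

text \<open>
  For a local ring: \<open>dim R\<close> elements of the maximal ideal that generate an ideal
  whose radical is the maximal ideal.
\<close>

definition system_of_parameters :: "('a, 'b) ring_scheme \<Rightarrow> 'a list \<Rightarrow> bool" where
  "system_of_parameters R xs \<longleftrightarrow>
     set xs \<subseteq> max_ideal R \<and>
     enat (length xs) = krull_dim R \<and>
     ideal_radical R (Idl\<^bsub>R\<^esub> (set xs)) = max_ideal R"

text \<open>
  Powers of ideals are powers in the multiplicative monoid \<^const>\<open>ideals_set\<close>,
  so the zeroth power is the unit ideal.
\<close>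

definition is_reduction :: "('a, 'b) ring_scheme \<Rightarrow> 'a set \<Rightarrow> 'a set \<Rightarrow> bool" where
  "is_reduction R J I \<longleftrightarrow>
     ideal J R \<and> J \<subseteq> I \<and>
     (\<exists>n :: nat. J \<cdot>\<^bsub>R\<^esub> (I [^]\<^bsub>ideals_set R\<^esub> n) = I [^]\<^bsub>ideals_set R\<^esub> (n + 1))"

definition core :: "('a, 'b) ring_scheme \<Rightarrow> 'a set \<Rightarrow> 'a set" where
  "core R I = \<Inter>{J. is_reduction R J I}"

definition minimal_prime :: "('a, 'b) ring_scheme \<Rightarrow> 'a set \<Rightarrow> bool" where
  "minimal_prime R P \<longleftrightarrow>
     primeideal P R \<and> (\<forall>Q. primeideal Q R \<longrightarrow> Q \<subseteq> P \<longrightarrow> Q = P)"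

text \<open>The set written \<open>R\<^sup>0\<close> in tight closure theory.\<close>

definition outside_minimal_primes :: "('a, 'b) ring_scheme \<Rightarrow> 'a set" where
  "outside_minimal_primes R = {c \<in> carrier R. \<forall>P. minimal_prime R P \<longrightarrow> c \<notin> P}"

definition frobenius_power :: "('a, 'b) ring_scheme \<Rightarrow> 'a set \<Rightarrow> nat \<Rightarrow> 'a set" where
  "frobenius_power R I q = Idl\<^bsub>R\<^esub> ((\<lambda>a. a [^]\<^bsub>R\<^esub> q) ` I)"

text \<open>In the following, \<open>p\<close> is meant to be the characteristic of \<open>R\<close>, a prime.\<close>

definition tight_closure :: "('a, 'b) ring_scheme \<Rightarrow> nat \<Rightarrow> 'a set \<Rightarrow> 'a set" where
  "tight_closure R p I =
     {x \<in> carrier R. \<exists>c \<in> outside_minimal_primes R. \<exists>e0. \<forall>e\<ge>e0.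
        c \<otimes>\<^bsub>R\<^esub> (x [^]\<^bsub>R\<^esub> (p ^ e)) \<in> frobenius_power R I (p ^ e)}"

definition is_star_reduction :: "('a, 'b) ring_scheme \<Rightarrow> nat \<Rightarrow> 'a set \<Rightarrow> 'a set \<Rightarrow> bool" where
  "is_star_reduction R p J I \<longleftrightarrow> ideal J R \<and> J \<subseteq> I \<and> I \<subseteq> tight_closure R p J"

definition star_core :: "('a, 'b) ring_scheme \<Rightarrow> nat \<Rightarrow> 'a set \<Rightarrow> 'a set" where
  "star_core R p I = \<Inter>{J. is_star_reduction R p J I}"

end

theory Submission
  imports Defs
begin

text \<open>
  A parameter ideal \<open>I\<close> has neither proper reductions nor proper \<open>*\<close>-reductions, so both
  cores equal \<open>I\<close>. Let \<open>J\<close> be strictly contained in \<open>I = (x\<^sub>1, \<dots>, x\<^sub>d)\<close>, with \<open>M\<close> the maximal ideal.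
  By Nakayama, modulo \<open>M I\<close> the ideal \<open>J\<close> lies in a hyperplane, spanned by \<open>d - 1\<close> elements
  \<open>y\<^sub>i\<close>, and \<open>I\<close> is spanned by the \<open>y\<^sub>i\<close> and one more element \<open>x\<close>. Fix \<open>c\<close> outside a minimal
  prime at which a longest chain of primes starts. Moving the \<open>y\<^sub>i\<close> by elements of \<open>M I\<close>
  (prime avoidance) and using Krull's principal ideal theorem \<open>d - 1\<close> times yields a prime
  \<open>Q\<close> containing the modified \<open>y\<^sub>i\<close>, not containing \<open>c\<close>, with no prime strictly between \<open>Q\<close>
  and \<open>M\<close>. Modulo \<open>Q\<close> one has \<open>I = (x)\<close> and \<open>J \<subseteq> M x\<close>. Then \<open>J I\<^sup>n = I\<^sup>n\<^sup>+\<^sup>1\<close> gives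
  \<open>x\<^sup>n\<^sup>+\<^sup>1 \<in> M x\<^sup>n\<^sup>+\<^sup>1\<close>, which is absurd, and \<open>c x\<^sup>q \<in> J\<^sup>[\<^sup>q\<^sup>]\<close> for large \<open>q\<close> forces \<open>c\<close> into the
  ideal of the \<open>q\<close>-th powers of \<open>M\<close>, hence into \<open>(c\<^sup>2)\<close>, since a power of
  \<open>M\<close> lies in \<open>(c\<^sup>2)\<close>; this is absurd for \<open>c \<in> M\<close>.
\<close>

no_notation Sum_Type.Plus (infixr \<open><+>\<close> 65)

section \<open>Ideal arithmetic, primes, and localization expressed by saturated ideals\<close>

context cring
begin

text \<open>Closure under negation is multiplication by \<open>\<ominus> \<one>\<close>.\<close>

lemma cring_idealI:
  assumes "A \<subseteq> carrier R" "\<zero> \<in> A"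
    and "\<And>x y. x \<in> A \<Longrightarrow> y \<in> A \<Longrightarrow> x \<oplus> y \<in> A"
    and mult: "\<And>r x. r \<in> carrier R \<Longrightarrow> x \<in> A \<Longrightarrow> r \<otimes> x \<in> A"
  shows "ideal A R"
proof (rule idealI[OF ring_axioms])
  have neg: "\<ominus> x \<in> A" if "x \<in> A" for x
    using mult[of "\<ominus> \<one>" x] that assms(1) by (auto simp: l_minus)
  show "subgroup A (add_monoid R)"
    using assms neg by unfold_locales (auto simp flip: a_inv_def)
  show "x \<otimes> a \<in> A" if "a \<in> A" "x \<in> carrier R" for a x
    using mult that by blast
  show "a \<otimes> x \<in> A" if "a \<in> A" "x \<in> carrier R" for a x
    using mult[of x a] that assms(1) m_comm[of a x] by auto
qed

lemma ideal_zero: "ideal A R \<Longrightarrow> \<zero> \<in> A"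
  by (simp add: additive_subgroup.zero_closed ideal.axioms(1))

lemma ideal_add: "ideal A R \<Longrightarrow> x \<in> A \<Longrightarrow> y \<in> A \<Longrightarrow> x \<oplus> y \<in> A"
  by (simp add: additive_subgroup.a_closed ideal.axioms(1))

lemma ideal_uminus: "ideal A R \<Longrightarrow> x \<in> A \<Longrightarrow> \<ominus> x \<in> A"
  by (simp add: additive_subgroup.a_inv_closed ideal.axioms(1))

lemma ideal_minus: "ideal A R \<Longrightarrow> x \<in> A \<Longrightarrow> y \<in> A \<Longrightarrow> x \<ominus> y \<in> A"
  by (simp add: ideal_add ideal_uminus a_minus_def)

lemma ideal_add_cancel:
  assumes "ideal A R" "x \<oplus> y \<in> A" "x \<in> A" "y \<in> carrier R"
  shows "y \<in> A"
proof -
  have "x \<in> carrier R" using assms ideal.Icarr by metis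
  then have "y = (x \<oplus> y) \<ominus> x" using assms(4) by algebra
  then show ?thesis using ideal_minus[OF assms(1,2,3)] by simp
qed

lemma ideal_minus_imp_add:
  assumes "ideal A R" "x \<ominus> y \<in> A" "y \<in> A" "x \<in> carrier R"
  shows "x \<in> A"
proof -
  have "y \<in> carrier R" using assms ideal.Icarr by metis
  then have "x = (x \<ominus> y) \<oplus> y" using assms(4) by algebra
  then show ?thesis using ideal_add[OF assms(1,2,3)] by simp
qed

lemma ideal_inter: "ideal A R \<Longrightarrow> ideal B R \<Longrightarrow> ideal (A \<inter> B) R"
  by (rule i_intersect)

lemma mem_set_add: "x \<in> A <+> B \<longleftrightarrow> (\<exists>a\<in>A. \<exists>b\<in>B. x = a \<oplus> b)"
  by (auto simp: set_add_def')

lemma mem_add_PIdl: "x \<in> A <+> PIdl g \<longleftrightarrow> (\<exists>a\<in>A. \<exists>b\<in>carrier R. x = a \<oplus> b \<otimes> g)"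
  by (auto simp: mem_set_add cgenideal_def)

lemma set_add_upper1: "ideal A R \<Longrightarrow> ideal B R \<Longrightarrow> A \<subseteq> A <+> B"
  using ideal_zero ideal.Icarr r_zero unfolding mem_set_add subset_iff by metis

lemma set_add_upper2: "ideal A R \<Longrightarrow> ideal B R \<Longrightarrow> B \<subseteq> A <+> B"
  using ideal_zero ideal.Icarr l_zero unfolding mem_set_add subset_iff by metis

lemma set_add_least: "ideal C R \<Longrightarrow> A \<subseteq> C \<Longrightarrow> B \<subseteq> C \<Longrightarrow> A <+> B \<subseteq> C"
  unfolding subset_iff mem_set_add using ideal_add by blast

lemma ideal_add_PIdl: "ideal A R \<Longrightarrow> g \<in> carrier R \<Longrightarrow> ideal (A <+> PIdl g) R"
  by (simp add: add_ideals cgenideal_ideal)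

lemma add_PIdl_upper: "ideal A R \<Longrightarrow> g \<in> carrier R \<Longrightarrow> A \<subseteq> A <+> PIdl g"
  by (simp add: set_add_upper1 cgenideal_ideal)

lemma add_PIdl_self: "ideal A R \<Longrightarrow> g \<in> carrier R \<Longrightarrow> g \<in> A <+> PIdl g"
  using set_add_upper2[of A "PIdl g"] cgenideal_ideal cgenideal_self by blast

lemma add_PIdl_least: "ideal C R \<Longrightarrow> A \<subseteq> C \<Longrightarrow> g \<in> C \<Longrightarrow> A <+> PIdl g \<subseteq> C"
  using set_add_least cgenideal_minimal by blast

lemma primeideal_ideal: "primeideal P R \<Longrightarrow> ideal P R"
  by (rule primeideal.axioms)

lemma primeideal_one: "primeideal P R \<Longrightarrow> \<one> \<notin> P"
  using ideal.one_imp_carrier primeideal.I_notcarr primeideal_ideal by metis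

lemma primeideal_mult_notin:
  "primeideal P R \<Longrightarrow> a \<in> carrier R - P \<Longrightarrow> b \<in> carrier R - P \<Longrightarrow> a \<otimes> b \<in> carrier R - P"
  using primeideal.I_prime by fastforce

lemma primeideal_pow_notin:
  "primeideal P R \<Longrightarrow> a \<in> carrier R - P \<Longrightarrow> a [^] (n :: nat) \<in> carrier R - P"
  by (induction n) (auto simp: primeideal_one primeideal_mult_notin[unfolded Diff_iff])

lemma primeideal_pow: "primeideal P R \<Longrightarrow> a \<in> carrier R \<Longrightarrow> a [^] (n :: nat) \<in> P \<Longrightarrow> a \<in> P"
  using primeideal_pow_notin by blast

text \<open>The contraction to \<open>R\<close> of the extension of \<open>N\<close> to the localization at \<open>P\<close>.\<close>

definition saturation :: "'a set \<Rightarrow> 'a set \<Rightarrow> 'a set" where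
  "saturation P N = {r \<in> carrier R. \<exists>s \<in> carrier R - P. s \<otimes> r \<in> N}"

lemma saturation_ideal:
  assumes "primeideal P R" "ideal N R"
  shows "ideal (saturation P N) R"
proof (rule cring_idealI)
  show "\<zero> \<in> saturation P N"
    using assms primeideal_one ideal_zero unfolding saturation_def by (auto intro!: bexI[of _ \<one>])
next
  fix x y assume "x \<in> saturation P N" "y \<in> saturation P N"
  then obtain s t where c: "x \<in> carrier R" "y \<in> carrier R" "s \<in> carrier R" "t \<in> carrier R"
    and s: "s \<in> carrier R - P" "s \<otimes> x \<in> N" and t: "t \<in> carrier R - P" "t \<otimes> y \<in> N"
    unfolding saturation_def by auto
  have "(s \<otimes> t) \<otimes> (x \<oplus> y) = t \<otimes> (s \<otimes> x) \<oplus> s \<otimes> (t \<otimes> y)"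
    using c by algebra
  also have "\<dots> \<in> N"
    by (intro ideal_add[OF assms(2)] ideal.I_l_closed[OF assms(2)] c s(2) t(2))
  finally show "x \<oplus> y \<in> saturation P N"
    using primeideal_mult_notin[OF assms(1) s(1) t(1)] c unfolding saturation_def by auto
next
  fix r x assume r: "r \<in> carrier R" "x \<in> saturation P N"
  then obtain s where c: "x \<in> carrier R" "s \<in> carrier R" and s: "s \<in> carrier R - P" "s \<otimes> x \<in> N"
    unfolding saturation_def by auto
  have "s \<otimes> (r \<otimes> x) = r \<otimes> (s \<otimes> x)" using r c by algebra
  then show "r \<otimes> x \<in> saturation P N"
    using s(1) r(1) c ideal.I_l_closed[OF assms(2) s(2) r(1)] unfolding saturation_def
    by (auto intro!: bexI[of _ s])
qed (auto simp: saturation_def)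

lemma saturation_upper: "primeideal P R \<Longrightarrow> ideal N R \<Longrightarrow> N \<subseteq> saturation P N"
  using primeideal_one ideal.Icarr unfolding saturation_def by (fastforce intro!: bexI[of _ \<one>])

lemma saturation_mono: "M \<subseteq> N \<Longrightarrow> saturation P M \<subseteq> saturation P N"
  unfolding saturation_def by auto

lemma saturation_cancel:
  assumes "primeideal P R" "s \<in> carrier R - P" "s \<otimes> r \<in> saturation P N" "r \<in> carrier R"
  shows "r \<in> saturation P N"
proof -
  obtain t where t: "t \<in> carrier R - P" "t \<otimes> (s \<otimes> r) \<in> N"
    using assms unfolding saturation_def by auto
  have "t \<otimes> (s \<otimes> r) = (t \<otimes> s) \<otimes> r" using t assms by (auto simp: m_assoc)
  then show ?thesis
    using t primeideal_mult_notin[OF assms(1) t(1) assms(2)] assms(4) unfolding saturation_def by auto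
qed

lemma saturation_idem: "primeideal P R \<Longrightarrow> saturation P (saturation P N) \<subseteq> saturation P N"
  using saturation_cancel unfolding saturation_def[of P "saturation P N"] by blast

end

section \<open>Noetherian tools: maximal elements, primes over an ideal, Nakayama\<close>

locale noetherian_cring = noetherian_ring + cring
begin

text \<open>In a Noetherian ring the union of a nonempty chain of ideals is a member of the chain,
  so Zorn's lemma applies to any nonempty family of ideals.\<close>

lemma maximal_ideal_in_family:
  assumes "F \<noteq> {}" "\<And>A. A \<in> F \<Longrightarrow> ideal A R"
  obtains M where "M \<in> F" "\<And>N. N \<in> F \<Longrightarrow> M \<subseteq> N \<Longrightarrow> N = M"
proof -
  have "\<exists>M\<in>F. \<forall>X\<in>F. M \<subseteq> X \<longrightarrow> X = M"
  proof (rule subset_Zorn)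
    fix C assume C: "subset.chain F C"
    show "\<exists>U\<in>F. \<forall>X\<in>C. X \<subseteq> U"
    proof (cases "C = {}")
      case True
      then show ?thesis using assms(1) by auto
    next
      case False
      moreover have "subset.chain {A. ideal A R} C"
        using C assms(2) unfolding pred_on.chain_def by auto
      ultimately have "\<Union>C \<in> C" by (rule ideal_chain_is_trivial)
      then show ?thesis using C unfolding pred_on.chain_def by auto
    qed
  qed
  then show ?thesis using that by blast
qed

lemma noetherian_induct [consumes 1, case_names step]:
  assumes "ideal N R"
    and step: "\<And>N. ideal N R \<Longrightarrow> (\<And>M. ideal M R \<Longrightarrow> N \<subset> M \<Longrightarrow> Q M) \<Longrightarrow> Q N"
  shows "Q N"
proof (rule ccontr)
  assume "\<not> Q N"
  then have "{N. ideal N R \<and> \<not> Q N} \<noteq> {}" using assms(1) by auto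
  then obtain M where "ideal M R" "\<not> Q M" "\<And>N. ideal N R \<Longrightarrow> \<not> Q N \<Longrightarrow> M \<subseteq> N \<Longrightarrow> N = M"
    by (rule maximal_ideal_in_family) auto
  then show False using step[of M] by blast
qed

text \<open>Noetherian induction. If \<open>a \<otimes> b \<in> N\<close> with neither factor in
  \<open>N\<close>, a prime over \<open>N\<close> lies over \<open>N + (a)\<close> or
  \<open>N + (b)\<close>, so the two finite families are united. The family need not consist of
  minimal primes only. The uniform exponent \<open>k\<close> later puts all powers
  \<open>a [^] k\<close> with \<open>a \<in> M\<close> into one ideal.\<close>

lemma finite_primes_over:
  assumes "ideal N R"
  obtains Ps k where "finite Ps" "\<forall>P\<in>Ps. primeideal P R \<and> N \<subseteq> P"
    "\<forall>P. primeideal P R \<longrightarrow> N \<subseteq> P \<longrightarrow> (\<exists>P'\<in>Ps. P' \<subseteq> P)"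
    "\<forall>a\<in>carrier R. (\<forall>P\<in>Ps. a \<in> P) \<longrightarrow> a [^] (k :: nat) \<in> N"
proof -
  define good where "good N Ps k \<longleftrightarrow> finite Ps \<and> (\<forall>P\<in>Ps. primeideal P R \<and> N \<subseteq> P) \<and>
    (\<forall>P. primeideal P R \<longrightarrow> N \<subseteq> P \<longrightarrow> (\<exists>P'\<in>Ps. P' \<subseteq> P)) \<and>
    (\<forall>a\<in>carrier R. (\<forall>P\<in>Ps. a \<in> P) \<longrightarrow> a [^] (k :: nat) \<in> N)" for N Ps k
  have "\<exists>Ps k. good N Ps k"
    using assms
  proof (induction N rule: noetherian_induct)
    case (step N)
    show ?case
    proof (cases "N = carrier R \<or> primeideal N R")
      case True
      then show ?thesis
      proof
        assume "N = carrier R"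
        then show ?thesis
          \<comment> \<open>No prime contains the unit ideal, so the empty family works; exponent 0
            is right because \<open>\<one> \<in> N\<close>.\<close>
          using primeideal_one unfolding good_def
            by (intro exI[of _ "{}"] exI[of _ 0]) auto
      next
        assume "primeideal N R"
        then show ?thesis
          unfolding good_def by (intro exI[of _ "{N}"] exI[of _ 1]) auto
      qed
    next
      case False
      then obtain a b where ab: "a \<in> carrier R" "b \<in> carrier R" "a \<otimes> b \<in> N" "a \<notin> N" "b \<notin> N"
        using step(1) is_cring by (metis primeidealI)
      note ideals = ideal_add_PIdl[OF step(1) ab(1)] ideal_add_PIdl[OF step(1) ab(2)]
      note up = add_PIdl_upper[OF step(1) ab(1)] add_PIdl_upper[OF step(1) ab(2)]
      have "N \<subset> N <+> PIdl a" "N \<subset> N <+> PIdl b"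
        using up add_PIdl_self[OF step(1) ab(1)] add_PIdl_self[OF step(1) ab(2)] ab by auto
      note IH = step(2)[OF ideals(1) this(1)] step(2)[OF ideals(2) this(2)]
      from IH obtain Ps k Qs l where good: "good (N <+> PIdl a) Ps k" "good (N <+> PIdl b) Qs l"
        by blast
      have cover: "\<exists>P'\<in>Ps. P' \<subseteq> P" if "primeideal P R" "N <+> PIdl a \<subseteq> P" for P
        using good(1) that unfolding good_def by simp
      have cover': "\<exists>P'\<in>Qs. P' \<subseteq> P" if "primeideal P R" "N <+> PIdl b \<subseteq> P" for P
        using good(2) that unfolding good_def by simp
      have "\<exists>P'\<in>Ps \<union> Qs. P' \<subseteq> P" if P: "primeideal P R" "N \<subseteq> P" for P
      proof -
        have "a \<in> P \<or> b \<in> P" using primeideal.I_prime[OF P(1) ab(1,2)] P(2) ab(3) by blast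
        then have "N <+> PIdl a \<subseteq> P \<or> N <+> PIdl b \<subseteq> P"
          using add_PIdl_least primeideal_ideal P by blast
        then show ?thesis using cover[OF P(1)] cover'[OF P(1)] by blast
      qed
      \<comment> \<open>The exponents add up because the product of \<open>N + (a)\<close> and
        \<open>N + (b)\<close> lies in \<open>N\<close>.\<close>
      moreover have "z [^] (k + l) \<in> N" if z: "z \<in> carrier R" "\<forall>P\<in>Ps \<union> Qs. z \<in> P" for z
      proof -
        have "z [^] k \<in> N <+> PIdl a" "z [^] l \<in> N <+> PIdl b" 
          using good z unfolding good_def by simp_all
        then obtain u v r t where e: "z [^] k = u \<oplus> r \<otimes> a" "z [^] l = v \<oplus> t \<otimes> b"
          and u: "u \<in> N" "v \<in> N" "r \<in> carrier R" "t \<in> carrier R"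
          unfolding mem_add_PIdl by blast
        have c: "u \<in> carrier R" "v \<in> carrier R" using u ideal.Icarr[OF step(1)] by auto
        have "z [^] (k + l) = z [^] k \<otimes> z [^] l" using z by (simp add: nat_pow_mult)
        also have "\<dots> = (v \<oplus> t \<otimes> b) \<otimes> u \<oplus> ((r \<otimes> a) \<otimes> v \<oplus> (r \<otimes> t) \<otimes> (a \<otimes> b))"
          unfolding e using c u ab by algebra
        also have "\<dots> \<in> N"
          using c u ab by (intro ideal_add[OF step(1)]) (simp_all add: ideal.I_l_closed[OF step(1)])
        finally show ?thesis .
      qed
      moreover have "\<forall>P\<in>Ps \<union> Qs. primeideal P R \<and> N \<subseteq> P"
      proof
        fix P assume "P \<in> Ps \<union> Qs"
        then have "primeideal P R \<and> (N <+> PIdl a \<subseteq> P \<or> N <+> PIdl b \<subseteq> P)"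
          using good unfolding good_def by auto
        then show "primeideal P R \<and> N \<subseteq> P" using up by (meson subset_trans)
      qed
      ultimately have "good N (Ps \<union> Qs) (k + l)"
        using good unfolding good_def by simp
      then show ?thesis by blast
    qed
  qed
  then obtain Ps k where "good N Ps k" by blast
  then show ?thesis by (intro that[of Ps k]) (simp_all add: good_def)
qed

text \<open>This is an associated prime of \<open>R/A\<close>: among the annihilators of nonzero
  elements of \<open>R/A\<close>, a maximal one is prime.\<close>

lemma prime_annihilator:
  assumes "ideal A R" "A \<noteq> carrier R"
  obtains g where "g \<in> carrier R" "g \<notin> A" "primeideal {r \<in> carrier R. g \<otimes> r \<in> A} R"
proof -
  let ?ann = "\<lambda>g. {r \<in> carrier R. g \<otimes> r \<in> A}"
  let ?F = "?ann ` (carrier R - A)"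
  have id: "ideal (?ann g) R" if "g \<in> carrier R" for g
    using that assms(1) is_cring by (intro ideal.helper_max_prime)
  have "?F \<noteq> {}" using assms ideal.Icarr[OF assms(1)] by auto
  then obtain M where M: "M \<in> ?F" "\<And>N. N \<in> ?F \<Longrightarrow> M \<subseteq> N \<Longrightarrow> N = M"
    using maximal_ideal_in_family[of ?F] id by blast
  then obtain g where g: "g \<in> carrier R" "g \<notin> A" "M = ?ann g" by auto
  have "primeideal (?ann g) R"
  proof (rule primeidealI[OF id is_cring])
    have "\<one> \<notin> ?ann g" using g by simp
    then show "carrier R \<noteq> ?ann g" by blast
  next
    fix a b assume ab: "a \<in> carrier R" "b \<in> carrier R" "a \<otimes> b \<in> ?ann g"
    show "a \<in> ?ann g \<or> b \<in> ?ann g"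
    proof (cases "g \<otimes> a \<in> A")
      case False
      \<comment> \<open>As \<open>g \<otimes> a\<close> is still nonzero modulo \<open>A\<close>,
        maximality turns this inclusion into an equality, and \<open>b\<close> annihilates
        \<open>g \<otimes> a\<close>.\<close>
      have "?ann g \<subseteq> ?ann (g \<otimes> a)"
      proof
        fix r assume r: "r \<in> ?ann g"
        then have "g \<otimes> a \<otimes> r = a \<otimes> (g \<otimes> r)" using ab g by (simp add: m_ac)
        then show "r \<in> ?ann (g \<otimes> a)" using r ab ideal.I_l_closed[OF assms(1)] by auto
      qed
      moreover have "?ann (g \<otimes> a) \<in> ?F" using False g ab by auto
      ultimately have "?ann (g \<otimes> a) = ?ann g" using M g by blast
      moreover have "b \<in> ?ann (g \<otimes> a)" using ab g by (simp add: m_assoc)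
      ultimately show ?thesis by blast
    qed (use ab in auto)
  qed (use g in auto)
  then show ?thesis using that g by blast
qed

text \<open>Nakayama over the local ring at \<open>P\<close>, phrased by saturation. Instead of a
  generating set, the proof takes \<open>L\<close> maximal among the ideals over \<open>K\<close>
  that do not contain \<open>N\<close> locally; then one element \<open>g\<close> generates
  \<open>N\<close> locally modulo \<open>L\<close>.\<close>

lemma nakayama:
  assumes P: "primeideal P R" and N: "ideal N R" and K: "ideal K R"
    and sub: "N \<subseteq> saturation P (K <+> P \<cdot> N)"
  shows "N \<subseteq> saturation P K"
proof (rule ccontr)
  assume "\<not> N \<subseteq> saturation P K"
  then have "{L. ideal L R \<and> K \<subseteq> L \<and> \<not> N \<subseteq> saturation P L} \<noteq> {}" (is "?F \<noteq> {}")
    using K by auto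
  then obtain L where "L \<in> ?F" and max: "\<And>M. M \<in> ?F \<Longrightarrow> L \<subseteq> M \<Longrightarrow> M = L"
    by (rule maximal_ideal_in_family) auto
  then have L: "ideal L R" "K \<subseteq> L" "\<not> N \<subseteq> saturation P L" by auto
  obtain g where g: "g \<in> N" "g \<notin> saturation P L" using L(3) by blast
  have gc: "g \<in> carrier R" using g N ideal.Icarr by metis
  have "L <+> PIdl g \<noteq> L"
    using g saturation_upper[OF P L(1)] add_PIdl_self[OF L(1) gc] by auto
  then have "L <+> PIdl g \<notin> ?F" using max add_PIdl_upper[OF L(1) gc] by blast
  then have NL: "N \<subseteq> saturation P (L <+> PIdl g)"
    using ideal_add_PIdl[OF L(1) gc] add_PIdl_upper[OF L(1) gc] L(2) by blast
  \<comment> \<open>Multiplying \<open>NL\<close> by \<open>P\<close> moves the coefficient of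
    \<open>g\<close> into \<open>P\<close>.\<close>
  have PN: "\<exists>s\<in>carrier R - P. \<exists>l\<in>L. \<exists>p\<in>P. s \<otimes> w = l \<oplus> p \<otimes> g" if "w \<in> P \<cdot> N" for w
    using that
  proof (induction w rule: ideal_prod.induct)
    case (prod i j)
    then obtain s l b where s: "s \<in> carrier R - P" "l \<in> L" "b \<in> carrier R" "s \<otimes> j = l \<oplus> b \<otimes> g"
      and j: "j \<in> carrier R"
      using NL unfolding saturation_def mem_add_PIdl by blast
    have i: "i \<in> carrier R" using prod P primeideal_ideal ideal.Icarr by metis
    have l: "l \<in> carrier R" using s L ideal.Icarr by metis
    have "s \<otimes> (i \<otimes> j) = i \<otimes> (s \<otimes> j)" using s i j by (simp add: m_ac)
    also have "\<dots> = i \<otimes> l \<oplus> (i \<otimes> b) \<otimes> g" unfolding s(4) using i l s gc by algebra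
    finally show ?case
      using s i prod ideal.I_l_closed[OF L(1)] ideal.I_r_closed[OF primeideal_ideal[OF P]] by metis
  next
    case (sum w1 w2)
    then obtain s1 l1 p1 s2 l2 p2 where
      1: "s1 \<in> carrier R - P" "l1 \<in> L" "p1 \<in> P" "s1 \<otimes> w1 = l1 \<oplus> p1 \<otimes> g" and
      2: "s2 \<in> carrier R - P" "l2 \<in> L" "p2 \<in> P" "s2 \<otimes> w2 = l2 \<oplus> p2 \<otimes> g" by blast
    have w: "w1 \<in> carrier R" "w2 \<in> carrier R"
      using sum ideal_prod_in_carrier[OF primeideal_ideal[OF P] N] by auto
    have c: "l1 \<in> carrier R" "l2 \<in> carrier R" "p1 \<in> carrier R" "p2 \<in> carrier R"
        "s1 \<in> carrier R" "s2 \<in> carrier R"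
      using 1 2 ideal.Icarr[OF L(1)] ideal.Icarr[OF primeideal_ideal[OF P]] by auto
    have "(s1 \<otimes> s2) \<otimes> (w1 \<oplus> w2) = s2 \<otimes> (s1 \<otimes> w1) \<oplus> s1 \<otimes> (s2 \<otimes> w2)"
      using w c by algebra
    also have "\<dots> = (s2 \<otimes> l1 \<oplus> s1 \<otimes> l2) \<oplus> (s2 \<otimes> p1 \<oplus> s1 \<otimes> p2) \<otimes> g"
      unfolding 1(4) 2(4) using c gc by algebra
    finally have "(s1 \<otimes> s2) \<otimes> (w1 \<oplus> w2) = \<dots>" .
    moreover have "s2 \<otimes> l1 \<oplus> s1 \<otimes> l2 \<in> L"
      by (intro ideal_add[OF L(1)] ideal.I_l_closed[OF L(1)] 1 2 c)
    moreover have "s2 \<otimes> p1 \<oplus> s1 \<otimes> p2 \<in> P"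
      by (intro ideal_add ideal.I_l_closed primeideal_ideal[OF P] 1 2 c)
    ultimately show ?case
      using primeideal_mult_notin[OF P 1(1) 2(1)] by blast
  qed
  obtain s k w where s: "s \<in> carrier R - P" "k \<in> K" "w \<in> P \<cdot> N" "s \<otimes> g = k \<oplus> w"
    using sub g unfolding saturation_def mem_set_add by blast
  obtain t l p where t: "t \<in> carrier R - P" "l \<in> L" "p \<in> P" "t \<otimes> w = l \<oplus> p \<otimes> g"
    using PN s by blast
  have c: "k \<in> carrier R" "l \<in> carrier R" "p \<in> carrier R" "w \<in> carrier R" "s \<in> carrier R" "t \<in> carrier R"
    using s t ideal.Icarr[OF L(1)] ideal.Icarr[OF primeideal_ideal[OF P]] L(2)
      ideal_prod_in_carrier[OF primeideal_ideal[OF P] N] by auto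
  \<comment> \<open>The factor \<open>t \<otimes> s \<ominus> p\<close> lies outside
    \<open>P\<close>, hence is a unit locally, and it carries \<open>g\<close> into
    \<open>L\<close>.\<close>
  have "(t \<otimes> s \<ominus> p) \<otimes> g = t \<otimes> (s \<otimes> g) \<ominus> p \<otimes> g" using c gc by algebra
  also have "\<dots> = t \<otimes> k \<oplus> t \<otimes> w \<ominus> p \<otimes> g" unfolding s(4) using c gc by algebra
  also have "\<dots> = t \<otimes> k \<oplus> l" unfolding t(4) using c gc by algebra
  also have "\<dots> \<in> L" using s t c L by (intro ideal_add[OF L(1)] ideal.I_l_closed[OF L(1)]) auto
  finally have "(t \<otimes> s \<ominus> p) \<otimes> g \<in> L" .
  moreover have "t \<otimes> s \<ominus> p \<notin> P"
    using ideal_minus_imp_add[OF primeideal_ideal[OF P], of "t \<otimes> s" p]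
      primeideal_mult_notin[OF P t(1) s(1)] t(3) by auto
  ultimately have "g \<in> saturation P L"
    using c gc unfolding saturation_def by auto
  then show False using g by simp
qed

end

section \<open>Krull's principal ideal theorem\<close>

context noetherian_cring
begin

text \<open>By \<open>min\<close>, the localization of \<open>R/B\<close> at \<open>P\<close> has a
  single prime, so it is Artinian. Saturated ideals stand for the ideals of the
  localization.\<close>

lemma saturated_chain_stabilizes:
  assumes P: "primeideal P R" and B: "ideal B R" "B \<subseteq> P"
    and min: "\<And>Q. primeideal Q R \<Longrightarrow> B \<subseteq> Q \<Longrightarrow> Q \<subseteq> P \<Longrightarrow> Q = P"
    and N: "\<And>n. ideal (N n) R" "\<And>n. B \<subseteq> N n" "\<And>n. saturation P (N n) \<subseteq> N n"
    and dec: "\<And>n :: nat. N (Suc n) \<subseteq> N n"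
  obtains n where "N (Suc n) = N n"
proof -
  have anti: "N n \<subseteq> N m" if "m \<le> n" for m n
    using lift_Suc_antimono_le[of N, OF dec that] .
  \<comment> \<open>The ideals on whose trace the chain becomes constant. A maximal one turns out to
    be the whole ring, since otherwise it can be enlarged by one composition factor.\<close>
  define F where "F = {A. ideal A R \<and> B \<subseteq> A \<and> saturation P A \<subseteq> A \<and>
    (\<exists>n0. \<forall>n\<ge>n0. N n \<inter> A = N n0 \<inter> A)}"
  have "saturation P B \<subseteq> N n" for n
    using saturation_mono[OF N(2)[of n], of P] N(3)[of n] by blast
  then have stable_B: "N n \<inter> saturation P B = saturation P B" for n by blast
  have "saturation P B \<in> F"
    unfolding F_def
    using saturation_ideal[OF P B(1)] saturation_upper[OF P B(1)] saturation_idem[OF P, of B]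
    by (simp add: stable_B)
  then have "F \<noteq> {}" by blast
  then obtain A where "A \<in> F" and max: "\<And>A'. A' \<in> F \<Longrightarrow> A \<subseteq> A' \<Longrightarrow> A' = A"
    by (rule maximal_ideal_in_family) (auto simp: F_def)
  then obtain n0 where A: "ideal A R" "B \<subseteq> A" "saturation P A \<subseteq> A"
    and n0: "\<And>n. n \<ge> n0 \<Longrightarrow> N n \<inter> A = N n0 \<inter> A"
    unfolding F_def by blast
  have "A = carrier R"
  proof (rule ccontr)
    assume "A \<noteq> carrier R"
    then obtain g where g: "g \<in> carrier R" "g \<notin> A" "primeideal {r \<in> carrier R. g \<otimes> r \<in> A} R"
      using prime_annihilator A(1) by blast
    let ?Q = "{r \<in> carrier R. g \<otimes> r \<in> A}"
    have satA: "r \<in> A" if "s \<in> carrier R - P" "s \<otimes> r \<in> A" "r \<in> carrier R" for s r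
      using that A(3) unfolding saturation_def by blast
    have "B \<subseteq> ?Q"
      using A g(1) ideal.I_l_closed[OF A(1)] ideal.Icarr[OF A(1)] by blast
    moreover have "?Q \<subseteq> P"
    proof
      fix r assume r: "r \<in> ?Q"
      then have "r \<otimes> g \<in> A" using g(1) m_comm[of r g] by auto
      then show "r \<in> P" using satA[of r g] g r by blast
    qed
    ultimately have "?Q = P" using min g(3) by blast
    \<comment> \<open>So modulo \<open>A\<close> the element \<open>g\<close> spans, locally, a copy
      of the residue field of \<open>P\<close>.\<close>
    then have gP: "b \<otimes> g \<in> A" if "b \<in> P" for b
      using that g(1) m_comm[of g b] by auto
    let ?A' = "saturation P (A <+> PIdl g)"
    have id: "ideal (A <+> PIdl g) R" using ideal_add_PIdl A(1) g(1) .
    have A': "ideal ?A' R" "A \<subseteq> ?A'" "g \<in> ?A'" "saturation P ?A' \<subseteq> ?A'"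
      using saturation_ideal[OF P id] saturation_upper[OF P id] add_PIdl_upper[OF A(1) g(1)]
        add_PIdl_self[OF A(1) g(1)] saturation_idem[OF P] by auto
    have A'D: "\<exists>s\<in>carrier R - P. \<exists>a\<in>A. \<exists>b\<in>carrier R. s \<otimes> r = a \<oplus> b \<otimes> g" if "r \<in> ?A'" for r
      using that unfolding saturation_def mem_add_PIdl by blast
    have "\<exists>n1. \<forall>n\<ge>n1. N n \<inter> ?A' = N n1 \<inter> ?A'"
    \<comment> \<open>As \<open>?A'/A\<close> is locally one-dimensional, each \<open>N n\<close>
      contributes either nothing or everything to it.\<close>
    proof (cases "\<exists>n1\<ge>n0. N n1 \<inter> ?A' \<subseteq> A")
      case True
      then obtain n1 where n1: "n1 \<ge> n0" "N n1 \<inter> ?A' \<subseteq> A" by blast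
      have "N n \<inter> ?A' = N n1 \<inter> ?A'" if "n \<ge> n1" for n
      proof -
        have "N n \<inter> ?A' = N n \<inter> A" "N n1 \<inter> ?A' = N n1 \<inter> A"
          using n1(2) anti[OF that] A'(2) by blast+
        then show ?thesis using n0[of n] n0[of n1] n1(1) that by simp
      qed
      then show ?thesis by blast
    next
      case False
      have "u \<in> N n" if u: "n \<ge> n0" "u \<in> N n0" "u \<in> ?A'" for n u
      proof -
        obtain r where r: "r \<in> N n" "r \<in> ?A'" "r \<notin> A" using False u(1) by blast
        have "r \<in> carrier R" "u \<in> carrier R"
          using r u ideal.Icarr[OF A'(1)] by auto
        obtain s a b where s: "s \<in> carrier R - P" "a \<in> A" "b \<in> carrier R" "s \<otimes> r = a \<oplus> b \<otimes> g"
          using A'D[OF r(2)] by blast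
        obtain s' a' b' where
          s': "s' \<in> carrier R - P" "a' \<in> A" "b' \<in> carrier R" "s' \<otimes> u = a' \<oplus> b' \<otimes> g"
          using A'D[OF u(3)] by blast
        have c: "a \<in> carrier R" "a' \<in> carrier R" "s \<in> carrier R" "s' \<in> carrier R"
          using s s' ideal.Icarr[OF A(1)] by auto
        note c = c s(3) s'(3) g(1) \<open>r \<in> carrier R\<close> \<open>u \<in> carrier R\<close>
        have "b \<notin> P"
        proof
          assume "b \<in> P"
          then have "s \<otimes> r \<in> A" using ideal_add[OF A(1) s(2) gP] s(4) by simp
          then show False using satA[OF s(1)] r(3) c by blast
        qed
        then have bs: "b \<otimes> s' \<in> carrier R - P" using primeideal_mult_notin[OF P] s(3) s'(1) by blast
        \<comment> \<open>This combination eliminates \<open>g\<close>, so it lies in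
          \<open>A\<close>, where the chain is already constant. With \<open>r \<in> N n\<close> it
          puts a unit multiple (locally) of \<open>u\<close> into \<open>N n\<close>.\<close>
        define z where "z = b \<otimes> (s' \<otimes> u) \<ominus> b' \<otimes> (s \<otimes> r)"
        have "z = b \<otimes> a' \<ominus> b' \<otimes> a"
          unfolding z_def s(4) s'(4) using c by algebra
        also have "\<dots> \<in> A"
          by (intro ideal_minus[OF A(1)] ideal.I_l_closed[OF A(1)] s s')
        finally have "z \<in> A" .
        moreover have "z \<in> N n0"
          unfolding z_def using r(1) anti[OF u(1)] u(2)
          by (intro ideal_minus[OF N(1)] ideal.I_l_closed[OF N(1)] c) auto
        ultimately have "z \<in> N n" using n0[OF u(1)] by blast
        then have "z \<oplus> b' \<otimes> (s \<otimes> r) \<in> N n"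
          by (intro ideal_add[OF N(1)] ideal.I_l_closed[OF N(1)] c r)
        moreover have "z \<oplus> b' \<otimes> (s \<otimes> r) = (b \<otimes> s') \<otimes> u"
          unfolding z_def using c by algebra
        ultimately show "u \<in> N n"
          using bs c N(3)[of n] unfolding saturation_def by auto
      qed
      then have "N n \<inter> ?A' = N n0 \<inter> ?A'" if "n \<ge> n0" for n
        using that anti[OF that] by blast
      then show ?thesis by blast
    qed
    then have "?A' \<in> F" using A' A(2) unfolding F_def by blast
    then show False using max A'(2,3) g(2) by blast
  qed
  then have "N (Suc n0) = N n0"
    using n0[of "Suc n0"] ideal.Icarr[OF N(1)[of "Suc n0"]] ideal.Icarr[OF N(1)[of n0]] by auto
  then show ?thesis using that by blast
qed

text \<open>
  After localizing at \<open>P\<close> and inverting \<open>y\<close>, the chain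
  of the \<open>a\<^sup>n\<close> becomes stationary, which forces \<open>a\<close> to divide a power of \<open>y\<close>.
\<close>

theorem krull_principal_ideal:
  assumes A0: "primeideal A0 R" and T: "primeideal T R" and P: "primeideal P R"
    and sub: "A0 \<subset> T" "T \<subset> P" and y: "y \<in> P"
  obtains Q where "primeideal Q R" "A0 \<subseteq> Q" "y \<in> Q" "Q \<subset> P"
proof (rule ccontr)
  assume neg: "\<not> thesis"
  note iA0 = primeideal_ideal[OF A0] and iT = primeideal_ideal[OF T] and iP = primeideal_ideal[OF P]
  have yc: "y \<in> carrier R" using y iP ideal.Icarr by metis
  have no: "\<not> (primeideal Q R \<and> A0 \<subseteq> Q \<and> y \<in> Q \<and> Q \<subset> P)" for Q using neg that by blast
  have yT: "y \<notin> T" using no[of T] T sub by blast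
  obtain a where a: "a \<in> T" "a \<notin> A0" using sub by blast
  have ac: "a \<in> carrier R" using a iT ideal.Icarr by metis
  define B where "B = A0 <+> PIdl y"
  have B: "ideal B R" "A0 \<subseteq> B" "y \<in> B" "B \<subseteq> P"
    unfolding B_def using ideal_add_PIdl[OF iA0 yc] add_PIdl_upper[OF iA0 yc]
      add_PIdl_self[OF iA0 yc] add_PIdl_least[OF iP] sub y by auto
  have min: "Q = P" if "primeideal Q R" "B \<subseteq> Q" "Q \<subseteq> P" for Q
    using no[of Q] that B by blast
  define D where "D n = A0 <+> PIdl (a [^] n)" for n :: nat
  have D: "ideal (D n) R" "A0 \<subseteq> D n" "a [^] n \<in> D n" for n
    unfolding D_def using ideal_add_PIdl[OF iA0] add_PIdl_upper[OF iA0] add_PIdl_self[OF iA0] ac by auto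
  \<comment> \<open>The contraction of \<open>D n\<close> from the localization at \<open>P\<close>
    with \<open>y\<close> inverted. Thus \<open>y\<close> is a nonzerodivisor modulo
    \<open>H n\<close>, which is \<open>H_y\<close> below.\<close>
  define H where "H n = {r \<in> carrier R. \<exists>t :: nat. y [^] t \<otimes> r \<in> saturation P (D n)}" for n
  have sD: "ideal (saturation P (D n)) R" for n using saturation_ideal[OF P D(1)] .
  have H: "ideal (H n) R" for n
  proof (rule cring_idealI)
    show "\<zero> \<in> H n" using ideal_zero[OF sD[of n]] yc unfolding H_def by auto
  next
    fix u v assume "u \<in> H n" "v \<in> H n"
    then obtain t k where c: "u \<in> carrier R" "v \<in> carrier R"
      and t: "y [^] (t :: nat) \<otimes> u \<in> saturation P (D n)" "y [^] (k :: nat) \<otimes> v \<in> saturation P (D n)"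
      unfolding H_def by blast
    define yt yk where "yt = y [^] t" "yk = y [^] k"
    have "yt \<in> carrier R" "yk \<in> carrier R" using yc by (auto simp: yt_yk_def)
    then have "(yt \<otimes> yk) \<otimes> (u \<oplus> v) = yk \<otimes> (yt \<otimes> u) \<oplus> yt \<otimes> (yk \<otimes> v)" using c by algebra
    also have "\<dots> \<in> saturation P (D n)"
      using t \<open>yt \<in> _\<close> \<open>yk \<in> _\<close> unfolding yt_yk_def[symmetric]
      by (intro ideal_add[OF sD]) (simp_all add: ideal.I_l_closed[OF sD])
    finally have "y [^] (t + k) \<otimes> (u \<oplus> v) \<in> saturation P (D n)"
      using yc by (simp add: nat_pow_mult yt_yk_def)
    then show "u \<oplus> v \<in> H n" using c unfolding H_def by blast
  next
    fix r x assume r: "r \<in> carrier R" "x \<in> H n"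
    then obtain t where t: "x \<in> carrier R" "y [^] (t :: nat) \<otimes> x \<in> saturation P (D n)"
      unfolding H_def by blast
    have "y [^] t \<otimes> (r \<otimes> x) = r \<otimes> (y [^] t \<otimes> x)" using r t yc by (simp add: m_ac)
    then have "y [^] t \<otimes> (r \<otimes> x) \<in> saturation P (D n)"
      using ideal.I_l_closed[OF sD t(2) r(1)] by simp
    then show "r \<otimes> x \<in> H n" using r t unfolding H_def by blast
  qed (auto simp: H_def)
  have D_H: "D n \<subseteq> H n" for n
  proof
    fix x assume "x \<in> D n"
    then have "x \<in> carrier R" "y [^] (0::nat) \<otimes> x \<in> saturation P (D n)"
      using saturation_upper[OF P D(1)[of n]] ideal.Icarr[OF D(1)] by auto
    then show "x \<in> H n" unfolding H_def by blast
  qed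
  have H_sat: "saturation P (H n) \<subseteq> H n" for n
  proof
    fix x assume "x \<in> saturation P (H n)"
    then obtain s t where s: "x \<in> carrier R" "s \<in> carrier R - P"
      "y [^] (t :: nat) \<otimes> (s \<otimes> x) \<in> saturation P (D n)"
      unfolding saturation_def[of P "H n"] unfolding H_def by blast
    have "y [^] t \<otimes> (s \<otimes> x) = s \<otimes> (y [^] t \<otimes> x)" using s yc by (auto simp: m_ac)
    then have "y [^] t \<otimes> x \<in> saturation P (D n)"
      using saturation_cancel[OF P s(2), of "y [^] t \<otimes> x"] s yc by simp
    then show "x \<in> H n" using s(1) unfolding H_def by blast
  qed
  have H_y: "b \<in> H n" if b: "y \<otimes> b \<in> H n" "b \<in> carrier R" for b n
  proof -
    obtain t where "y [^] (t :: nat) \<otimes> (y \<otimes> b) \<in> saturation P (D n)"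
      using b unfolding H_def by blast
    then have "y [^] Suc t \<otimes> b \<in> saturation P (D n)" using yc b(2) by (simp add: m_assoc)
    then show ?thesis using b(2) unfolding H_def by blast
  qed
  have "D (Suc n) \<subseteq> D n" for n
    unfolding D_def[of "Suc n"] using D ac
    by (intro add_PIdl_least) (auto intro: ideal.I_r_closed)
  then have H_dec: "H (Suc n) \<subseteq> H n" for n
    unfolding H_def using saturation_mono[of "D (Suc n)" "D n" P] by blast
  \<comment> \<open>Adding \<open>y\<close> gives ideals over \<open>B\<close>, over which
    \<open>P\<close> is minimal; so this chain, unlike \<open>H\<close> itself, is covered by
    \<open>saturated_chain_stabilizes\<close>.\<close>
  define N where "N n = saturation P (H n <+> PIdl y)" for n
  have idHy: "ideal (H n <+> PIdl y) R" for n using ideal_add_PIdl[OF H yc] .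
  have N1: "ideal (N n) R" and N3: "saturation P (N n) \<subseteq> N n" for n
    unfolding N_def using saturation_ideal[OF P idHy] saturation_idem[OF P] by auto
  have N2: "B \<subseteq> N n" for n
  proof -
    have "A0 \<subseteq> H n" using D(2) D_H by blast
    then have "B \<subseteq> H n <+> PIdl y"
      unfolding B_def using add_PIdl_upper[OF H yc, of n] add_PIdl_self[OF H yc]
      by (intro add_PIdl_least idHy) auto
    then show ?thesis unfolding N_def using saturation_upper[OF P idHy] by blast
  qed
  have "H (Suc n) <+> PIdl y \<subseteq> H n <+> PIdl y" for n
    using H_dec[of n] add_PIdl_upper[OF H yc, of n] add_PIdl_self[OF H yc]
    by (intro add_PIdl_least idHy) auto
  then have N4: "N (Suc n) \<subseteq> N n" for n
    unfolding N_def by (rule saturation_mono)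
  obtain n where n: "N (Suc n) = N n"
    using saturated_chain_stabilizes[where N = N, OF P B(1,4) min N1 N2 N3 N4] by blast
  \<comment> \<open>Locally an element of \<open>H n\<close> is \<open>h + b y\<close> with
    \<open>h \<in> H (Suc n)\<close>. Then \<open>b y\<close>, and hence \<open>b\<close>, lies in
    \<open>H n\<close>, so \<open>b y \<in> P \<cdot> H n\<close> and Nakayama removes this
    term.\<close>
  have "H n \<subseteq> saturation P (H (Suc n) <+> P \<cdot> H n)"
  proof
    fix r assume r: "r \<in> H n"
    have rc: "r \<in> carrier R" using r ideal.Icarr[OF H] by blast
    have "r \<in> N n"
      unfolding N_def using saturation_upper[OF P idHy] add_PIdl_upper[OF H yc] r by blast
    then obtain s h b where s: "s \<in> carrier R - P" "h \<in> H (Suc n)" "b \<in> carrier R"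
      "s \<otimes> r = h \<oplus> b \<otimes> y"
      unfolding n[symmetric] unfolding N_def saturation_def mem_add_PIdl by blast
    have hc: "h \<in> carrier R" using s ideal.Icarr[OF H] by blast
    have "s \<otimes> r \<in> H n" using ideal.I_l_closed[OF H r] s by blast
    then have "h \<oplus> b \<otimes> y \<in> H n" using s(4) by simp
    then have "b \<otimes> y \<in> H n"
      using ideal_add_cancel[OF H, of h "b \<otimes> y" n] s H_dec[of n] yc by auto
    then have "b \<in> H n" using H_y[of b] s(3) m_comm[OF s(3) yc] by simp
    then have "b \<otimes> y \<in> P \<cdot> H n"
      using ideal_prod.prod[OF y, of b "H n" R] m_comm[OF s(3) yc] by simp
    then show "r \<in> saturation P (H (Suc n) <+> P \<cdot> H n)"
      using s rc unfolding saturation_def mem_set_add by blast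
  qed
  then have "H n \<subseteq> H (Suc n)"
    using nakayama[OF P H H] H_sat by blast
  then have "a [^] n \<in> H (Suc n)" using D(3) D_H by blast
  then obtain t s where s: "s \<in> carrier R - P" "s \<otimes> (y [^] (t :: nat) \<otimes> a [^] n) \<in> D (Suc n)"
    unfolding H_def saturation_def by blast
  then obtain u b where u: "u \<in> A0" "b \<in> carrier R"
    "s \<otimes> (y [^] t \<otimes> a [^] n) = u \<oplus> b \<otimes> (a [^] Suc n)"
    unfolding D_def mem_add_PIdl by blast
  define an yt where "an = a [^] n" "yt = y [^] t"
  have c: "an \<in> carrier R" "yt \<in> carrier R" "s \<in> carrier R" "u \<in> carrier R"
    using ac yc s u ideal.Icarr[OF iA0] by (auto simp: an_yt_def)
  have "s \<otimes> (yt \<otimes> an) = u \<oplus> b \<otimes> (an \<otimes> a)" using u(3) by (simp add: an_yt_def)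
  moreover have "an \<otimes> (s \<otimes> yt \<ominus> a \<otimes> b) = s \<otimes> (yt \<otimes> an) \<ominus> b \<otimes> (an \<otimes> a)"
    using c u(2) ac by algebra
  moreover have "u \<oplus> b \<otimes> (an \<otimes> a) \<ominus> b \<otimes> (an \<otimes> a) = u"
    using c u(2) ac by algebra
  \<comment> \<open>Cancelling \<open>an\<close> modulo the prime \<open>A0\<close> leaves
    \<open>s \<otimes> yt\<close> congruent to \<open>a \<otimes> b\<close>, an element of
    \<open>T\<close>; but neither \<open>s\<close> nor \<open>y\<close> lies in
    \<open>T\<close>.\<close>
  ultimately have "an \<otimes> (s \<otimes> yt \<ominus> a \<otimes> b) \<in> A0" using u(1) by simp
  moreover have "an \<notin> A0"
    using primeideal_pow[OF A0 ac, of n] a(2) unfolding an_yt_def by blast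
  ultimately have "s \<otimes> yt \<ominus> a \<otimes> b \<in> A0"
    using primeideal.I_prime[OF A0, of an "s \<otimes> yt \<ominus> a \<otimes> b"] c u(2) ac by auto
  then have "s \<otimes> yt \<in> T"
    using ideal_minus_imp_add[OF iT, of "s \<otimes> yt" "a \<otimes> b"] sub(1) c u(2)
      ideal.I_r_closed[OF iT a(1) u(2)] by auto
  then have "s \<in> T \<or> yt \<in> T"
    using primeideal.I_prime[OF T, of s yt] c by simp
  then have "yt \<in> T" using s(1) sub(2) by auto
  then show False
    using primeideal_pow[OF T yc, of t] yT unfolding an_yt_def by simp
qed

end

section \<open>Chains of primes\<close>

context cring
begin

lemma prime_avoids_inter:
  assumes "primeideal P R" "finite As" "\<And>A. A \<in> As \<Longrightarrow> ideal A R \<and> \<not> A \<subseteq> P"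
  obtains z where "z \<in> carrier R" "z \<notin> P" "\<And>A. A \<in> As \<Longrightarrow> z \<in> A"
proof -
  have "\<exists>z\<in>carrier R - P. \<forall>A\<in>As. z \<in> A"
    using assms(2,3)
  proof (induction As rule: finite_induct)
    case empty
    then show ?case using primeideal_one[OF assms(1)] by (intro bexI[of _ \<one>]) auto
  next
    case (insert B As)
    then obtain z where z: "z \<in> carrier R - P" "\<forall>A\<in>As. z \<in> A" by blast
    obtain b where b: "b \<in> B" "b \<notin> P" using insert.prems by blast
    have "ideal B R" using insert.prems by blast
    then have "b \<in> carrier R" using b(1) by (rule ideal.Icarr)
    then have "b \<otimes> z \<in> carrier R - P" using primeideal_mult_notin[OF assms(1)] b z by blast
    moreover have "b \<otimes> z \<in> A" if "A \<in> insert B As" for A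
    proof -
      have "ideal A R" using that insert.prems by blast
      then show ?thesis
        using that b(1) z \<open>b \<in> carrier R\<close> ideal.I_r_closed[of A R b z] ideal.I_l_closed[of A R z b]
        by auto
    qed
    ultimately show ?case by blast
  qed
  then show ?thesis using that by blast
qed

text \<open>Induction on the number of primes. A minimal \<open>P\<close> is set aside; if the
  \<open>w\<close> found for the others fails at \<open>P\<close>, it is corrected by some
  \<open>z\<close> that lies in \<open>A\<close> and in all the other primes but not in
  \<open>P\<close>.\<close>

lemma coset_prime_avoidance:
  assumes "ideal A R" "y \<in> carrier R"
    and "finite Ps" "\<And>P. P \<in> Ps \<Longrightarrow> primeideal P R \<and> \<not> A \<subseteq> P"
  obtains w where "w \<in> A" "\<forall>P\<in>Ps. y \<oplus> w \<notin> P"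
proof -
  have "\<exists>w\<in>A. \<forall>P\<in>Ps. y \<oplus> w \<notin> P"
    using assms(3,4)
  proof (induction Ps rule: finite_psubset_induct)
    case (psubset Ps)
    show ?case
    proof (cases "Ps = {}")
      case True
      then show ?thesis using ideal_zero[OF assms(1)] by blast
    next
      case False
      then obtain P where P: "P \<in> Ps" and min: "\<And>Q. Q \<in> Ps \<Longrightarrow> Q \<subseteq> P \<Longrightarrow> P = Q"
        using finite_has_minimal[OF psubset.hyps(1)] by blast
      have prime: "primeideal P R" using P psubset.prems by blast
      have "Ps - {P} \<subset> Ps" using P by blast
      then have "\<exists>w\<in>A. \<forall>Q\<in>Ps - {P}. y \<oplus> w \<notin> Q"
        using psubset.prems by (intro psubset.IH) auto
      then obtain w where w: "w \<in> A" "\<And>Q. Q \<in> Ps \<Longrightarrow> Q \<noteq> P \<Longrightarrow> y \<oplus> w \<notin> Q" by blast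
      have wc: "w \<in> carrier R" using w ideal.Icarr[OF assms(1)] by blast
      show ?thesis
      proof (cases "y \<oplus> w \<in> P")
        case False
        then show ?thesis using w by blast
      next
        case True
        have "ideal B R \<and> \<not> B \<subseteq> P" if "B \<in> insert A (Ps - {P})" for B
          using that assms(1) psubset.prems min P primeideal_ideal by blast
        then obtain z where z: "z \<in> carrier R" "z \<notin> P" "\<And>B. B \<in> insert A (Ps - {P}) \<Longrightarrow> z \<in> B"
          using prime_avoids_inter[OF prime, of "insert A (Ps - {P})"] psubset.hyps(1) by auto
        have e: "y \<oplus> (w \<oplus> z) = (y \<oplus> w) \<oplus> z" "y \<oplus> (w \<oplus> z) = z \<oplus> (y \<oplus> w)"
          using assms(2) wc z(1) by algebra+
        have "y \<oplus> (w \<oplus> z) \<notin> Q" if "Q \<in> Ps" for Q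
        proof
          assume *: "y \<oplus> (w \<oplus> z) \<in> Q"
          have Q: "ideal Q R" using that psubset.prems primeideal_ideal by blast
          show False
          proof (cases "Q = P")
            case True
            then show False
              using ideal_add_cancel[OF Q, of "y \<oplus> w" z] * \<open>y \<oplus> w \<in> P\<close> z e(1) by simp
          next
            case False
            then have "z \<in> Q" using z(3) that by blast
            then show False
              using ideal_add_cancel[OF Q, of z "y \<oplus> w"] * w(2)[OF that False] e(2) assms(2) wc by simp
          qed
        qed
        then show ?thesis using ideal_add[OF assms(1) w(1)] z(3) by blast
      qed
    qed
  qed
  then show ?thesis using that by blast
qed

text \<open>The number counts strict inclusions from \<open>P\<close> up to \<open>M\<close>.
  Recursion from the bottom, in place of the indexed chains of \<open>krull_dim\<close>, lets
  inductions replace the lower end; primality of the bottom member is stated separately.\<close>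

primrec prime_chain :: "'a set \<Rightarrow> nat \<Rightarrow> 'a set \<Rightarrow> bool" where
  "prime_chain M 0 P \<longleftrightarrow> P = M"
| "prime_chain M (Suc n) P \<longleftrightarrow> (\<exists>P'. primeideal P' R \<and> P \<subset> P' \<and> prime_chain M n P')"

lemma prime_chain_subset: "prime_chain M n P \<Longrightarrow> P \<subseteq> M"
  by (induction n arbitrary: P) auto

lemma prime_chain_psubset: "prime_chain M (Suc n) P \<Longrightarrow> P \<subset> M"
  using prime_chain_subset by (metis prime_chain.simps(2) psubset_subset_trans)

lemma prime_chain_of_fun:
  assumes "\<forall>i\<le>n. primeideal (f i) R" "\<forall>i<n. f i \<subset> f (Suc i)"
  shows "prime_chain (f n) n (f 0)"
  using assms
proof (induction n arbitrary: f)
  case (Suc n)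
  have "prime_chain (f (Suc n)) n (f (Suc 0))"
    using Suc.IH[of "\<lambda>i. f (Suc i)"] Suc.prems by auto
  moreover have "primeideal (f (Suc 0)) R" "f 0 \<subset> f (Suc 0)" using Suc.prems by auto
  ultimately show ?case by (auto simp del: psubsetI)
qed simp

lemma fun_of_prime_chain:
  assumes "prime_chain M n P" "primeideal P R"
  shows "\<exists>f. f 0 = P \<and> (\<forall>i\<le>n. primeideal (f i) R) \<and> (\<forall>i<n. f i \<subset> f (Suc i))"
  using assms
proof (induction n arbitrary: P)
  case (Suc n)
  then obtain P' where P': "primeideal P' R" "P \<subset> P'" "prime_chain M n P'" by auto
  then obtain f where f: "f 0 = P'" "\<forall>i\<le>n. primeideal (f i) R" "\<forall>i<n. f i \<subset> f (Suc i)"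
    using Suc.IH[OF P'(3,1)] by blast
  define g where "g = case_nat P f"
  have "primeideal (g i) R" if "i \<le> Suc n" for i
    using that Suc.prems(2) f(2) by (cases i) (auto simp: g_def)
  moreover have "g i \<subset> g (Suc i)" if "i < Suc n" for i
    using that P'(2) f by (cases i) (auto simp: g_def)
  ultimately show ?case by (intro exI[of _ g]) (auto simp: g_def)
qed auto

lemma prime_chain_length_le:
  assumes "prime_chain M n P" "primeideal P R"
  shows "enat n \<le> krull_dim R"
  unfolding krull_dim_def using fun_of_prime_chain[OF assms] by (intro SUP_upper) blast

text \<open>A finite supremum of natural numbers is attained. A chain of maximal length must start
  at a minimal prime and end at \<open>M\<close>, or it could be prolonged.\<close>

lemma longest_prime_chain:
  assumes dim: "krull_dim R = enat d" and M: "primeideal M R"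
    and sub: "\<And>P. primeideal P R \<Longrightarrow> P \<subseteq> M"
  obtains P where "minimal_prime R P" "prime_chain M d P" "\<not> prime_chain M (Suc d) P"
proof -
  define S where "S = {n. \<exists>P :: nat \<Rightarrow> 'a set.
    (\<forall>i\<le>n. primeideal (P i) R) \<and> (\<forall>i<n. P i \<subset> P (Suc i))}"
  have dimS: "(SUP n\<in>S. enat n) = enat d" using dim unfolding krull_dim_def S_def .
  have "0 \<in> S" unfolding S_def using M by auto
  have "d \<in> S"
  proof (rule ccontr)
    assume "d \<notin> S"
    have le: "n \<le> d" if "n \<in> S" for n
      using SUP_upper[OF that, of enat] dimS by simp
    then have "d > 0" using \<open>0 \<in> S\<close> \<open>d \<notin> S\<close> by (cases d) auto
    \<comment> \<open>If \<open>d\<close> were missed, \<open>d - 1\<close> would already be an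
      upper bound; \<open>d > 0\<close> makes it strictly smaller.\<close>
    have "n \<le> d - 1" if "n \<in> S" for n using le[OF that] that \<open>d \<notin> S\<close> by (cases "n = d") auto
    then have "(SUP n\<in>S. enat n) \<le> enat (d - 1)" by (intro SUP_least) simp
    then show False using dimS \<open>d > 0\<close> by simp
  qed
  then obtain f where f: "\<forall>i\<le>d. primeideal (f i) R" "\<forall>i<d. f i \<subset> f (Suc i)"
    unfolding S_def by blast
  have chain: "prime_chain (f d) d (f 0)" by (rule prime_chain_of_fun[OF f])
  have f0: "primeideal (f 0) R" using f by blast
  have long: "\<not> prime_chain N (Suc d) P" if "primeideal P R" for N P
    using prime_chain_length_le[of N "Suc d" P] that dim by auto
  have "f d = M"
  proof (rule ccontr)
    assume ne: "f d \<noteq> M"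
    define g where "g = f (Suc d := M)"
    have "\<forall>i\<le>Suc d. primeideal (g i) R" using f(1) M by (auto simp: g_def le_Suc_eq)
    moreover have "f d \<subset> M" using ne sub f(1) by blast
    then have "\<forall>i<Suc d. g i \<subset> g (Suc i)" using f(2) by (auto simp: g_def less_Suc_eq)
    ultimately have "prime_chain (g (Suc d)) (Suc d) (g 0)" by (rule prime_chain_of_fun)
    moreover have "primeideal (g 0) R" using f0 by (simp add: g_def)
    ultimately show False using long by blast
  qed
  have "Q = f 0" if Q: "primeideal Q R" "Q \<subseteq> f 0" for Q
  proof (rule ccontr)
    assume "Q \<noteq> f 0"
    then have "prime_chain M (Suc d) Q" using Q chain f0 \<open>f d = M\<close> by auto
    then show False using long[OF Q(1)] by blast
  qed
  then have "minimal_prime R (f 0)" using f0 unfolding minimal_prime_def by blast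
  then show ?thesis using that chain long[OF f0] \<open>f d = M\<close> by blast
qed

end

section \<open>Chains of primes in Noetherian rings, by the principal ideal theorem\<close>

context noetherian_cring
begin

text \<open>The element \<open>y\<close> is pushed down the chain: if the second member above
  \<open>P\<close> contains \<open>y\<close>, the principal ideal theorem replaces the first one by
  a prime containing \<open>y\<close>, without changing the length.\<close>

lemma prime_chain_through:
  assumes "prime_chain M (Suc (Suc n)) P" "primeideal P R" "primeideal M R" "y \<in> M"
  shows "\<exists>P'. primeideal P' R \<and> P \<subset> P' \<and> y \<in> P' \<and> prime_chain M (Suc n) P'"
  using assms(1,2)
proof (induction n arbitrary: P)
  case 0
  then obtain P1 where P1: "primeideal P1 R" "P \<subset> P1" "P1 \<subset> M" by auto
  show ?case
  proof (cases "y \<in> P")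
    case True
    then show ?thesis using P1 assms(3) by auto
  next
    case False
    obtain Q where "primeideal Q R" "P \<subseteq> Q" "y \<in> Q" "Q \<subset> M"
      using krull_principal_ideal[OF 0(2) P1(1) assms(3) P1(2,3) assms(4)] .
    then show ?thesis using False assms(3) by auto
  qed
next
  case (Suc n)
  then obtain P1 where P1: "primeideal P1 R" "P \<subset> P1" "prime_chain M (Suc (Suc n)) P1" by auto
  then obtain P2 where P2: "primeideal P2 R" "P1 \<subset> P2" "y \<in> P2" "prime_chain M (Suc n) P2"
    using Suc.IH[OF P1(3,1)] by blast
  show ?case
  proof (cases "y \<in> P")
    case True
    then show ?thesis using P1 by blast
  next
    case False
    obtain Q where "primeideal Q R" "P \<subseteq> Q" "y \<in> Q" "Q \<subset> P2"
      using krull_principal_ideal[OF Suc.prems(2) P1(1) P2(1) P1(2) P2(2,3)] .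
    moreover from this have "prime_chain M (Suc (Suc n)) Q"
      using P2(1,4) unfolding prime_chain.simps(2)[of M "Suc n" Q] by blast
    ultimately show ?thesis using False by blast
  qed
qed

text \<open>
  The element \<open>y + w\<close> avoids the primes minimal over \<open>P + (c)\<close>, so by the principal
  ideal theorem a prime minimal over \<open>P + (y + w)\<close> cannot contain \<open>c\<close>.
\<close>

lemma prime_chain_step:
  assumes P: "primeideal P R" and M: "primeideal M R" and chain: "prime_chain M (Suc (Suc n)) P"
    and c: "c \<in> carrier R" "c \<notin> P"
    and A: "ideal A R" "A \<subseteq> M" "\<And>Q. primeideal Q R \<Longrightarrow> A \<subseteq> Q \<Longrightarrow> Q = M"
    and y: "y \<in> M"
  obtains w P' where "w \<in> A" "primeideal P' R" "P \<subset> P'" "y \<oplus> w \<in> P'" "c \<notin> P'"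
    "prime_chain M (Suc n) P'"
proof -
  have iP: "ideal P R" and iM: "ideal M R" using P M primeideal_ideal by auto
  have yc: "y \<in> carrier R" using y ideal.Icarr[OF iM] by blast
  obtain Ts and k :: nat where Ts: "finite Ts" "\<forall>T\<in>Ts. primeideal T R \<and> P <+> PIdl c \<subseteq> T"
    "\<forall>Q. primeideal Q R \<longrightarrow> P <+> PIdl c \<subseteq> Q \<longrightarrow> (\<exists>T\<in>Ts. T \<subseteq> Q)"
    "\<forall>a\<in>carrier R. (\<forall>Q\<in>Ts. a \<in> Q) \<longrightarrow> a [^] k \<in> P <+> PIdl c"
    using finite_primes_over[OF ideal_add_PIdl[OF iP c(1)]] .
  have "\<not> A \<subseteq> P" using A(3)[OF P] prime_chain_psubset[OF chain] by blast
  \<comment> \<open>The only prime over \<open>A\<close> is \<open>M\<close>, which cannot be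
    avoided because \<open>y \<oplus> w \<in> M\<close>; it is therefore left out.\<close>
  moreover define S where "S = insert P {T \<in> Ts. \<not> A \<subseteq> T}"
  ultimately have S: "finite S" "\<And>T. T \<in> S \<Longrightarrow> primeideal T R \<and> \<not> A \<subseteq> T"
    using P Ts(1,2) by auto
  obtain w where w: "w \<in> A" "\<forall>T\<in>S. y \<oplus> w \<notin> T"
    using coset_prime_avoidance[OF A(1) yc S] .
  define z where "z = y \<oplus> w"
  have z: "z \<in> M" "z \<notin> P" "z \<in> carrier R"
    using ideal_add[OF iM y, of w] w(1) w(2) A(2) ideal.Icarr[OF iM] by (auto simp: z_def S_def)
  obtain P1 where P1: "primeideal P1 R" "P \<subset> P1" "z \<in> P1" "prime_chain M (Suc n) P1"
    using prime_chain_through[OF chain P M z(1)] by blast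
  obtain Us and k :: nat where Us: "finite Us" "\<forall>U\<in>Us. primeideal U R \<and> P <+> PIdl z \<subseteq> U"
    "\<forall>Q. primeideal Q R \<longrightarrow> P <+> PIdl z \<subseteq> Q \<longrightarrow> (\<exists>U\<in>Us. U \<subseteq> Q)"
    "\<forall>a\<in>carrier R. (\<forall>Q\<in>Us. a \<in> Q) \<longrightarrow> a [^] k \<in> P <+> PIdl z"
    using finite_primes_over[OF ideal_add_PIdl[OF iP z(3)]] .
  have "P <+> PIdl z \<subseteq> P1"
    using add_PIdl_least[OF primeideal_ideal[OF P1(1)]] P1 by blast
  then have "{U \<in> Us. U \<subseteq> P1} \<noteq> {}" using Us(3) P1(1) by blast
  \<comment> \<open>Minimality within \<open>Us\<close> below \<open>P1\<close> makes
    \<open>P'\<close> minimal over \<open>P + (z)\<close>, since every prime over that ideal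
    contains a member of \<open>Us\<close>.\<close>
  then obtain P' where P': "P' \<in> Us" "P' \<subseteq> P1" and min: "\<And>U. U \<in> Us \<Longrightarrow> U \<subseteq> P1 \<Longrightarrow> U \<subseteq> P' \<Longrightarrow> P' = U"
    using finite_has_minimal[of "{U \<in> Us. U \<subseteq> P1}"] Us(1) by auto
  have prime: "primeideal P' R" and up: "P <+> PIdl z \<subseteq> P'" using P' Us(2) by auto
  have zP': "z \<in> P'" and PP': "P \<subseteq> P'"
    using up add_PIdl_upper[OF iP z(3)] add_PIdl_self[OF iP z(3)] by auto
  have chain': "prime_chain M (Suc n) P'" 
    using P1(4) P'(2) unfolding prime_chain.simps by (meson subset_psubset_trans)
  have "c \<notin> P'"
  proof
    assume cP': "c \<in> P'"
    then have "P <+> PIdl c \<subseteq> P'"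
      using add_PIdl_least[OF primeideal_ideal[OF prime] PP'] by blast
    then obtain T where T: "T \<in> Ts" "T \<subseteq> P'" using Ts(3) prime by blast
    have pT: "primeideal T R" and upT: "P <+> PIdl c \<subseteq> T" using Ts(2) T(1) by auto
    have "T \<noteq> M" using T(2) prime_chain_psubset[OF chain'] by blast
    then have "z \<notin> T" using w(2) T(1) A(3)[OF pT] by (auto simp: z_def S_def)
    then have "T \<subset> P'" using T(2) zP' by blast
    \<comment> \<open>Now \<open>P \<subset> T \<subset> P'\<close> and \<open>z \<in> P'\<close>,
      so the principal ideal theorem gives a prime over \<open>P + (z)\<close> strictly below
      \<open>P'\<close>.\<close>
    moreover have "P \<subset> T"
      using upT add_PIdl_upper[OF iP c(1)] add_PIdl_self[OF iP c(1)] c(2) by blast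
    ultimately obtain Q where Q: "primeideal Q R" "P \<subseteq> Q" "z \<in> Q" "Q \<subset> P'"
      using krull_principal_ideal[OF P pT prime] zP' by blast
    then have "P <+> PIdl z \<subseteq> Q" using add_PIdl_least[OF primeideal_ideal] by blast
    then obtain U where "U \<in> Us" "U \<subseteq> Q" using Us(3) Q(1) by blast
    then show False using min[of U] Q(4) P'(2) by blast
  qed
  then show ?thesis
    using that[OF w(1) prime] zP' PP' z(2) chain' unfolding z_def by blast
qed

text \<open>Each element of \<open>ys\<close> costs one application of
  \<open>prime_chain_step\<close> and one step of the chain. Chains from the new prime cannot be
  longer either, so at the end exactly one step remains below \<open>M\<close>.\<close>

lemma prime_avoiding_near_list:
  assumes M: "primeideal M R" and P: "primeideal P R"
    and chain: "prime_chain M (Suc (length ys)) P" "\<not> prime_chain M (Suc (Suc (length ys))) P"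
    and c: "c \<in> carrier R" "c \<notin> P"
    and A: "ideal A R" "A \<subseteq> M" "\<And>Q. primeideal Q R \<Longrightarrow> A \<subseteq> Q \<Longrightarrow> Q = M"
    and ys: "set ys \<subseteq> M"
  shows "\<exists>Q. primeideal Q R \<and> P \<subseteq> Q \<and> c \<notin> Q \<and> prime_chain M 1 Q \<and> \<not> prime_chain M 2 Q \<and>
    set ys \<subseteq> Q <+> A"
  using P chain c(2) ys
proof (induction ys arbitrary: P)
  case Nil
  then show ?case by (intro exI[of _ P]) (auto simp: numeral_2_eq_2)
next
  case (Cons y ys)
  have ch: "prime_chain M (Suc (Suc (length ys))) P" using Cons.prems(2) by simp
  have y: "y \<in> M" using Cons.prems by simp
  obtain w P' where w: "w \<in> A" "primeideal P' R" "P \<subset> P'" "y \<oplus> w \<in> P'" "c \<notin> P'"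
    "prime_chain M (Suc (length ys)) P'"
    using prime_chain_step[OF Cons.prems(1) M ch c(1) Cons.prems(4) A y] .
  have "\<not> prime_chain M (Suc (Suc (length ys))) P'"
    using Cons.prems(3) w(2,3) by (metis length_Cons prime_chain.simps(2))
  then obtain Q where Q: "primeideal Q R" "P' \<subseteq> Q" "c \<notin> Q" "prime_chain M 1 Q"
    "\<not> prime_chain M 2 Q" "set ys \<subseteq> Q <+> A"
    using Cons.IH[OF w(2,6) _ w(5)] Cons.prems by auto
  have "y \<in> carrier R" "w \<in> carrier R"
    using y w(1) A ideal.Icarr[OF primeideal_ideal[OF M]] by auto
  then have "y = (y \<oplus> w) \<oplus> \<ominus> w" by algebra
  moreover have "\<ominus> w \<in> A" using ideal_uminus[OF A(1) w(1)] .
  ultimately have "y \<in> Q <+> A" unfolding mem_set_add using w(4) Q(2) by blast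
  then show ?case using Q w(3) by (intro exI[of _ Q]) auto
qed

end

section \<open>Parameter ideals of local rings\<close>

locale noetherian_local_ring = noetherian_cring +
  fixes M
  assumes maximal: "maximalideal M R"
    and unique: "\<And>N. maximalideal N R \<Longrightarrow> N = M"
begin

lemma M_prime: "primeideal M R"
  using maximal by (rule maximalideal_prime)

lemma M_ideal: "ideal M R"
  using M_prime by (rule primeideal_ideal)

lemma proper_ideal_subset:
  assumes "ideal N R" "N \<noteq> carrier R"
  shows "N \<subseteq> M"
proof -
  let ?F = "{K. ideal K R \<and> N \<subseteq> K \<and> K \<noteq> carrier R}"
  have "?F \<noteq> {}" using assms by auto
  then obtain K where K: "K \<in> ?F" "\<And>L. L \<in> ?F \<Longrightarrow> K \<subseteq> L \<Longrightarrow> L = K"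
    by (rule maximal_ideal_in_family) auto
  have "maximalideal K R"
    using K by (intro maximalidealI) auto
  then show ?thesis using unique K(1) by blast
qed

lemma primeideal_subset: "primeideal P R \<Longrightarrow> P \<subseteq> M"
  using proper_ideal_subset primeideal_ideal primeideal.I_notcarr by metis

lemma unit_if_notin_M:
  assumes "r \<in> carrier R" "r \<notin> M"
  shows "r \<in> Units R"
proof -
  have "PIdl r = carrier R"
    using proper_ideal_subset[OF cgenideal_ideal[OF assms(1)]] cgenideal_self[OF assms(1)] assms(2)
    by blast
  then have "\<one> \<in> PIdl r" by simp
  then obtain x where "x \<in> carrier R" "\<one> = x \<otimes> r" unfolding cgenideal_def by blast
  then show ?thesis using assms(1) m_comm[of x r] unfolding Units_def by auto
qed

text \<open>Elements outside \<open>M\<close> are units, so localizing at \<open>M\<close> changes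
  nothing.\<close>

lemma saturation_M:
  assumes "ideal K R"
  shows "saturation M K \<subseteq> K"
proof
  fix r assume "r \<in> saturation M K"
  then obtain s where s: "r \<in> carrier R" "s \<in> carrier R" "s \<notin> M" "s \<otimes> r \<in> K"
    unfolding saturation_def by blast
  have u: "s \<in> Units R" using unit_if_notin_M s by blast
  then have "inv s \<otimes> (s \<otimes> r) = r" using s by (simp add: m_assoc[symmetric])
  then show "r \<in> K" using ideal.I_l_closed[OF assms s(4) Units_inv_closed[OF u]] by simp
qed

lemma nakayama_local:
  assumes "ideal N R" "ideal K R" "N \<subseteq> K <+> M \<cdot> N"
  shows "N \<subseteq> K"
proof -
  have "ideal (K <+> M \<cdot> N) R" using assms M_ideal by (intro add_ideals ideal_prod_is_ideal)
  then have "N \<subseteq> saturation M (K <+> M \<cdot> N)" using saturation_upper[OF M_prime] assms(3) by blast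
  then have "N \<subseteq> saturation M K" using nakayama[OF M_prime assms(1,2)] by blast
  then show ?thesis using saturation_M[OF assms(2)] by blast
qed

text \<open>
  Modulo \<open>M I\<close>, the proper subspace \<open>J\<close> lies in a hyperplane, spanned by \<open>ys\<close>, with
  complement spanned by \<open>x\<close>.
\<close>

lemma hyperplane_generators:
  assumes xs: "set xs \<subseteq> carrier R" and I: "I = Idl (set xs)"
    and J: "ideal J R" "J \<subset> I"
  obtains ys x where "length xs = Suc (length ys)" "set ys \<subseteq> I" "x \<in> I"
    "\<forall>T. ideal T R \<longrightarrow> M \<cdot> I \<subseteq> T \<longrightarrow> set ys \<subseteq> T \<longrightarrow> J \<subseteq> T \<and> I \<subseteq> T <+> PIdl x"
proof -
  have iI: "ideal I R" and xsI: "set xs \<subseteq> I"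
    unfolding I using genideal_ideal[OF xs] genideal_self[OF xs] by auto
  have iMI: "ideal (M \<cdot> I) R" and MI: "M \<cdot> I \<subseteq> I"
    using ideal_prod_is_ideal[OF M_ideal iI] ideal_prod_inter[OF M_ideal iI] by auto
  define J0 where "J0 = J <+> M \<cdot> I"
  have J0: "ideal J0 R" "J \<subseteq> J0" "M \<cdot> I \<subseteq> J0" "J0 \<subseteq> I"
    unfolding J0_def using add_ideals[OF J(1) iMI] set_add_upper1[OF J(1) iMI]
      set_add_upper2[OF J(1) iMI] set_add_least[OF iI _ MI] J(2) by auto
  \<comment> \<open>Otherwise Nakayama would give \<open>I \<subseteq> J\<close>.\<close>
  have "J0 \<noteq> I"
    using nakayama_local[OF iI J(1)] J(2) unfolding J0_def by blast
  \<comment> \<open>A maximal member is the preimage of a hyperplane of \<open>I/MI\<close>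
    containing the image of \<open>J\<close>.\<close>
  let ?F = "{K. ideal K R \<and> J0 \<subseteq> K \<and> K \<subseteq> I \<and> K \<noteq> I}"
  have "?F \<noteq> {}" using J0 \<open>J0 \<noteq> I\<close> by auto
  then obtain K where K: "K \<in> ?F" and max: "\<And>L. L \<in> ?F \<Longrightarrow> K \<subseteq> L \<Longrightarrow> L = K"
    by (rule maximal_ideal_in_family) auto
  then have iK: "ideal K R" and JK: "J0 \<subseteq> K" and KI: "K \<subset> I" by auto
  have "\<not> set xs \<subseteq> K" using genideal_minimal[OF iK, of "set xs"] KI I by blast
  then obtain x where x: "x \<in> set xs" "x \<notin> K" by blast
  have xc: "x \<in> carrier R" and xI: "x \<in> I" using x xs xsI by auto
  have "K <+> PIdl x \<notin> ?F"
    using max[of "K <+> PIdl x"] add_PIdl_upper[OF iK xc] add_PIdl_self[OF iK xc] x(2) by blast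
  moreover have "K <+> PIdl x \<subseteq> I" using add_PIdl_least[OF iI] KI xI by blast
  ultimately have KxI: "K <+> PIdl x = I"
    using ideal_add_PIdl[OF iK xc] add_PIdl_upper[OF iK xc] JK by blast
  have "\<exists>a\<in>carrier R. z \<ominus> a \<otimes> x \<in> K" if "z \<in> set xs" for z
  proof -
    have "z \<in> K <+> PIdl x" using KxI xsI that by blast
    then obtain k a where k: "k \<in> K" "a \<in> carrier R" "z = k \<oplus> a \<otimes> x" unfolding mem_add_PIdl by blast
    have "k \<in> carrier R" using k ideal.Icarr[OF iK] by blast
    then have "z \<ominus> a \<otimes> x = k" unfolding k(3) using k(2) xc by algebra
    then show ?thesis using k by blast
  qed
  then obtain a where a: "\<And>z. z \<in> set xs \<Longrightarrow> a z \<in> carrier R \<and> z \<ominus> a z \<otimes> x \<in> K" by metis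
  \<comment> \<open>One occurrence of \<open>x\<close> is removed, so the length drops by exactly
    one even if \<open>x\<close> is repeated.\<close>
  obtain us vs where uv: "xs = us @ x # vs" using x(1) by (meson split_list)
  define ys where "ys = map (\<lambda>z. z \<ominus> a z \<otimes> x) (us @ vs)"
  have ysK: "set ys \<subseteq> K" using a uv by (auto simp: ys_def)
  have "J \<subseteq> T \<and> I \<subseteq> T <+> PIdl x" if T: "ideal T R" "M \<cdot> I \<subseteq> T" "set ys \<subseteq> T" for T
  proof -
    \<comment> \<open>Working inside \<open>K\<close> puts \<open>b \<otimes> x\<close> into
      \<open>K\<close> below. As \<open>x \<notin> K\<close>, the coefficient \<open>b\<close>
      cannot be a unit, and \<open>b \<otimes> x \<in> M \<cdot> I \<subseteq> T\<close>.\<close>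
    define T' where "T' = T \<inter> K"
    have iT': "ideal T' R" unfolding T'_def using ideal_inter T(1) iK .
    have T'x: "ideal (T' <+> PIdl x) R" using ideal_add_PIdl[OF iT' xc] .
    have "set xs \<subseteq> T' <+> PIdl x"
    proof
      fix z assume z: "z \<in> set xs"
      show "z \<in> T' <+> PIdl x"
      proof (cases "z = x")
        case True
        then show ?thesis using add_PIdl_self[OF iT' xc] by simp
      next
        case False
        then have "z \<ominus> a z \<otimes> x \<in> T'" using z uv T(3) ysK by (auto simp: ys_def T'_def)
        moreover have "z = (z \<ominus> a z \<otimes> x) \<oplus> a z \<otimes> x"
        proof -
          have "z \<in> carrier R" "a z \<in> carrier R" using a z xs by auto
          then show ?thesis using xc by algebra
        qed
        ultimately show ?thesis unfolding mem_add_PIdl using a z by blast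
      qed
    qed
    then have IT': "I \<subseteq> T' <+> PIdl x" unfolding I using genideal_minimal[OF T'x] by blast
    have "J \<subseteq> T"
    proof
      fix j assume j: "j \<in> J"
      then have jK: "j \<in> K" using J0(2) JK by blast
      have "j \<in> T' <+> PIdl x" using j J(2) IT' by blast
      then obtain t b where t: "t \<in> T'" "b \<in> carrier R" "j = t \<oplus> b \<otimes> x"
        unfolding mem_add_PIdl by blast
      have "b \<otimes> x \<in> K"
        using ideal_add_cancel[OF iK, of t "b \<otimes> x"] t jK xc unfolding T'_def by auto
      have "b \<in> M"
      proof (rule ccontr)
        assume "b \<notin> M"
        then have u: "b \<in> Units R" using unit_if_notin_M t(2) by blast
        then have "inv b \<otimes> (b \<otimes> x) = x" using xc t(2) by (simp add: m_assoc[symmetric])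
        then show False
          using ideal.I_l_closed[OF iK \<open>b \<otimes> x \<in> K\<close> Units_inv_closed[OF u]] x(2) by simp
      qed
      then have "b \<otimes> x \<in> T" using ideal_prod.prod[of b M x I R] xI T(2) by blast
      then show "j \<in> T" using ideal_add[OF T(1)] t unfolding T'_def by blast
    qed
    moreover have "T' <+> PIdl x \<subseteq> T <+> PIdl x" 
      unfolding T'_def subset_iff mem_add_PIdl by blast
    ultimately show ?thesis using IT' by blast
  qed
  moreover have "length xs = Suc (length ys)" by (simp add: uv ys_def)
  ultimately show ?thesis using that ysK KI xI by blast
qed

text \<open>
  The quotient by \<open>Q\<close> is a one-dimensional domain in which \<open>c\<close> stays nonzero, \<open>I\<close> becomes
  principal and \<open>J\<close> stays properly contained in \<open>I\<close>.
\<close>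

lemma one_dimensional_reduction:
  assumes I: "ideal I R" "I \<subseteq> M" "\<And>Q. primeideal Q R \<Longrightarrow> I \<subseteq> Q \<Longrightarrow> Q = M"
    and hyp: "\<forall>T. ideal T R \<longrightarrow> M \<cdot> I \<subseteq> T \<longrightarrow> set ys \<subseteq> T \<longrightarrow> J \<subseteq> T \<and> I \<subseteq> T <+> PIdl x"
    and ys: "set ys \<subseteq> I" and x: "x \<in> I"
    and P: "primeideal P R" "prime_chain M (Suc (length ys)) P"
      "\<not> prime_chain M (Suc (Suc (length ys))) P"
    and c: "c \<in> carrier R" "c \<notin> P"
  obtains Q where "primeideal Q R" "Q \<subset> M" "c \<notin> Q" "x \<notin> Q"
    "\<forall>T. primeideal T R \<longrightarrow> Q \<subset> T \<longrightarrow> T = M" "I \<subseteq> Q <+> PIdl x"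
    "\<forall>j\<in>J. \<exists>r\<in>Q. \<exists>a\<in>M. j = r \<oplus> a \<otimes> x"
proof -
  let ?A = "M \<cdot> I"
  have A: "ideal ?A R" "?A \<subseteq> M"
    using ideal_prod_is_ideal[OF M_ideal I(1)] ideal_prod_inter[OF M_ideal I(1)] by auto
  \<comment> \<open>A prime over \<open>M \<cdot> I\<close> contains \<open>M\<close> or
    \<open>I\<close>, so the generators may be moved within \<open>M \<cdot> I\<close>.\<close>
  have Amax: "Q = M" if "primeideal Q R" "?A \<subseteq> Q" for Q
    using primeideal_divides_ideal_prod[OF that(1) M_ideal I(1) that(2)] primeideal_subset[OF that(1)]
      I(3)[OF that(1)] by blast
  have "set ys \<subseteq> M" using ys I(2) by blast
  from prime_avoiding_near_list[OF M_prime P c A Amax this]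
  obtain Q where Q: "primeideal Q R" "c \<notin> Q" "prime_chain M 1 Q" "\<not> prime_chain M 2 Q"
    "set ys \<subseteq> Q <+> ?A" by blast
  have iQ: "ideal Q R" using Q(1) by (rule primeideal_ideal)
  have QM: "Q \<subset> M" using prime_chain_psubset[of M 0 Q] Q(3) by simp
  have xc: "x \<in> carrier R" using x ideal.Icarr[OF I(1)] by blast
  have iQA: "ideal (Q <+> ?A) R" and "?A \<subseteq> Q <+> ?A"
    using add_ideals[OF iQ A(1)] set_add_upper2[OF iQ A(1)] by auto
  then have JI: "J \<subseteq> Q <+> ?A" "I \<subseteq> (Q <+> ?A) <+> PIdl x" using hyp Q(5) by auto
  have iQx: "ideal (Q <+> PIdl x) R" using ideal_add_PIdl[OF iQ xc] .
  \<comment> \<open>The generators \<open>ys\<close> lie in \<open>Q\<close> only up to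
    \<open>M \<cdot> I\<close>; Nakayama absorbs this error.\<close>
  have IQx: "I \<subseteq> Q <+> PIdl x"
  proof (rule nakayama_local[OF I(1) iQx])
    have ideal: "ideal ((Q <+> PIdl x) <+> ?A) R" using add_ideals[OF iQx A(1)] .
    have "Q <+> PIdl x \<subseteq> (Q <+> PIdl x) <+> ?A" "?A \<subseteq> (Q <+> PIdl x) <+> ?A"
      using set_add_upper1[OF iQx A(1)] set_add_upper2[OF iQx A(1)] by auto
    moreover have "Q \<subseteq> Q <+> PIdl x" "x \<in> Q <+> PIdl x"
      using add_PIdl_upper[OF iQ xc] add_PIdl_self[OF iQ xc] by auto
    ultimately have "(Q <+> ?A) <+> PIdl x \<subseteq> (Q <+> PIdl x) <+> ?A"
      by (intro add_PIdl_least set_add_least ideal) auto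
    then show "I \<subseteq> (Q <+> PIdl x) <+> ?A" using JI(2) by blast
  qed
  have MI: "\<exists>r\<in>Q. \<exists>a\<in>M. w = r \<oplus> a \<otimes> x" if "w \<in> ?A" for w
    using that
  proof (induction w rule: ideal_prod.induct)
    case (prod i j)
    then have "j \<in> Q <+> PIdl x" using IQx by blast
    then obtain r b where r: "r \<in> Q" "b \<in> carrier R" "j = r \<oplus> b \<otimes> x"
      unfolding mem_add_PIdl by blast
    have c: "i \<in> carrier R" "r \<in> carrier R"
      using prod(1) r(1) ideal.Icarr[OF M_ideal] ideal.Icarr[OF iQ] by auto
    then have "i \<otimes> j = i \<otimes> r \<oplus> (i \<otimes> b) \<otimes> x" unfolding r(3) using r(2) xc by algebra
    then show ?case
      using ideal.I_l_closed[OF iQ r(1) c(1)] ideal.I_r_closed[OF M_ideal prod(1) r(2)] by blast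
  next
    case (sum s1 s2)
    then obtain r1 a1 r2 a2 where s: "r1 \<in> Q" "a1 \<in> M" "s1 = r1 \<oplus> a1 \<otimes> x"
      "r2 \<in> Q" "a2 \<in> M" "s2 = r2 \<oplus> a2 \<otimes> x" by blast
    have "r1 \<in> carrier R" "a1 \<in> carrier R" "r2 \<in> carrier R" "a2 \<in> carrier R"
      using s ideal.Icarr[OF M_ideal] ideal.Icarr[OF iQ] by auto
    then have "s1 \<oplus> s2 = (r1 \<oplus> r2) \<oplus> (a1 \<oplus> a2) \<otimes> x" unfolding s(3,6) using xc by algebra
    then show ?case using ideal_add[OF iQ s(1,4)] ideal_add[OF M_ideal s(2,5)] by blast
  qed
  have "\<exists>r\<in>Q. \<exists>a\<in>M. j = r \<oplus> a \<otimes> x" if "j \<in> J" for j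
  proof -
    have "j \<in> Q <+> ?A" using JI(1) that by blast
    then obtain q w where q: "q \<in> Q" "w \<in> ?A" "j = q \<oplus> w" unfolding mem_set_add by blast
    obtain r a where r: "r \<in> Q" "a \<in> M" "w = r \<oplus> a \<otimes> x" using MI[OF q(2)] by blast
    have "q \<in> carrier R" "r \<in> carrier R" "a \<in> carrier R"
      using q r ideal.Icarr[OF M_ideal] ideal.Icarr[OF iQ] by auto
    then have "j = (q \<oplus> r) \<oplus> a \<otimes> x" unfolding q(3) r(3) using xc by algebra
    then show ?thesis using ideal_add[OF iQ q(1) r(1)] r(2) by blast
  qed
  \<comment> \<open>A prime strictly between \<open>Q\<close> and \<open>M\<close> would give a
    chain with two steps.\<close>
  moreover have "T = M" if "primeideal T R" "Q \<subset> T" for T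
    using that Q(4) primeideal_subset[OF that(1)] M_prime by (auto simp: numeral_2_eq_2)
  moreover have "x \<notin> Q"
  proof
    assume "x \<in> Q"
    then have "I \<subseteq> Q" using IQx add_PIdl_least[OF iQ] by blast
    then show False using I(3)[OF Q(1)] QM by blast
  qed
  ultimately show ?thesis
    using Q(1,2) QM IQx by (intro that[of Q]) blast+
qed

end

section \<open>Powers modulo an ideal, and the trivial reduction and
  \<open>*\<close>-reduction\<close>

context cring
begin

lemma ideals_set_simps:
  "\<one>\<^bsub>ideals_set R\<^esub> = carrier R" "A \<otimes>\<^bsub>ideals_set R\<^esub> B = A \<cdot> B"
  by (simp_all add: ideals_set_def)

lemma pow_in_ideals_pow: "x \<in> I \<Longrightarrow> x [^] n \<in> I [^]\<^bsub>ideals_set R\<^esub> (n :: nat)"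
  by (induction n) (auto simp: ideals_set_simps intro: ideal_prod.prod)

lemma ideals_pow_subset:
  assumes "ideal Q R" "x \<in> carrier R" "I \<subseteq> Q <+> PIdl x"
  shows "I [^]\<^bsub>ideals_set R\<^esub> n \<subseteq> Q <+> PIdl (x [^] (n :: nat))"
proof (induction n)
  case 0
  have "r \<in> Q <+> PIdl \<one>" if "r \<in> carrier R" for r
    unfolding mem_add_PIdl using that ideal_zero[OF assms(1)] by (intro bexI[of _ \<zero>] bexI[of _ r]) auto
  then show ?case by (auto simp: ideals_set_simps)
next
  case (Suc n)
  have xn: "x [^] n \<in> carrier R" "x [^] Suc n \<in> carrier R" using assms(2) by auto
  show ?case
  proof
    fix w assume "w \<in> I [^]\<^bsub>ideals_set R\<^esub> Suc n"
    then have "w \<in> (I [^]\<^bsub>ideals_set R\<^esub> n) \<cdot> I" by (simp add: ideals_set_simps)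
    then show "w \<in> Q <+> PIdl (x [^] Suc n)"
    proof (induction w rule: ideal_prod.induct)
      case (prod i j)
      have "i \<in> Q <+> PIdl (x [^] n)" "j \<in> Q <+> PIdl x" using prod Suc assms(3) by auto
      then obtain r a s b where e: "r \<in> Q" "a \<in> carrier R" "i = r \<oplus> a \<otimes> x [^] n"
        "s \<in> Q" "b \<in> carrier R" "j = s \<oplus> b \<otimes> x"
        unfolding mem_add_PIdl by blast
      define y where "y = x [^] n"
      have c: "r \<in> carrier R" "s \<in> carrier R" "y \<in> carrier R"
        using e ideal.Icarr[OF assms(1)] xn by (auto simp: y_def)
      have "i \<otimes> j = ((s \<oplus> b \<otimes> x) \<otimes> r \<oplus> (a \<otimes> y) \<otimes> s) \<oplus> (a \<otimes> b) \<otimes> (y \<otimes> x)"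
        unfolding e(3,6) y_def[symmetric] using c e(2,5) assms(2) by algebra
      moreover have "(s \<oplus> b \<otimes> x) \<otimes> r \<oplus> (a \<otimes> y) \<otimes> s \<in> Q"
        using c e assms(2) by (intro ideal_add[OF assms(1)]) (simp_all add: ideal.I_l_closed[OF assms(1)])
      ultimately show ?case unfolding mem_add_PIdl using e(2,5) by (auto simp: y_def)
    next
      case (sum s1 s2)
      then show ?case using ideal_add[OF ideal_add_PIdl[OF assms(1) xn(2)]] by blast
    qed
  qed
qed

text \<open>Used to replace \<open>j\<close> by \<open>a \<otimes> x\<close> inside a
  \<open>q\<close>-th power, where \<open>j\<close> is congruent to \<open>a \<otimes> x\<close>
  modulo \<open>Q\<close>.\<close>

lemma pow_cong_mod_ideal:
  assumes "ideal Q R" "r \<in> Q" "u \<in> carrier R"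
  shows "(r \<oplus> u) [^] (n :: nat) \<ominus> u [^] n \<in> Q"
proof (induction n)
  case 0
  then show ?case using ideal_zero[OF assms(1)] by (simp add: a_minus_def r_neg)
next
  case (Suc n)
  define v w where "v = (r \<oplus> u) [^] n" "w = u [^] n"
  have rc: "r \<in> carrier R" using assms ideal.Icarr by metis
  have c: "v \<in> carrier R" "w \<in> carrier R" using rc assms(3) by (auto simp: v_w_def)
  have "v \<otimes> (r \<oplus> u) \<ominus> w \<otimes> u = (v \<ominus> w) \<otimes> (r \<oplus> u) \<oplus> w \<otimes> r"
    using c rc assms(3) by algebra
  also have "\<dots> \<in> Q"
    using Suc c rc assms(2,3) unfolding v_w_def[symmetric]
    by (intro ideal_add[OF assms(1)] ideal.I_l_closed[OF assms(1)] ideal.I_r_closed[OF assms(1)]) auto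
  finally show ?case by (simp add: v_w_def)
qed

lemma one_outside_minimal_primes: "\<one> \<in> outside_minimal_primes R"
  unfolding outside_minimal_primes_def minimal_prime_def using primeideal_one by auto

lemma tight_closure_upper:
  assumes "ideal I R"
  shows "I \<subseteq> tight_closure R p I"
proof
  fix x assume x: "x \<in> I"
  have "x [^] (p ^ e) \<in> frobenius_power R I (p ^ e)" for e
    unfolding frobenius_power_def using genideal_self[of "(\<lambda>a. a [^] (p ^ e)) ` I"] x
      ideal.Icarr[OF assms] by auto
  moreover have "x \<in> carrier R" using x ideal.Icarr[OF assms] by blast
  ultimately show "x \<in> tight_closure R p I"
    unfolding tight_closure_def using one_outside_minimal_primes
    by (auto intro!: bexI[of _ \<one>])
qed

lemma is_reduction_refl: "ideal I R \<Longrightarrow> is_reduction R I I"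
  unfolding is_reduction_def
  by (auto intro!: exI[of _ 0] simp: ideals_set_simps ideal_prod_one
      ideal_prod_commute[OF oneideal])

lemma is_star_reduction_refl: "ideal I R \<Longrightarrow> is_star_reduction R p I I"
  unfolding is_star_reduction_def using tight_closure_upper by blast

end

section \<open>Parameter ideals have no proper reductions and no proper
  \<open>*\<close>-reductions\<close>

context noetherian_local_ring
begin

context
  fixes xs I
  assumes xs: "set xs \<subseteq> M" and I_def: "I = Idl (set xs)"
    and primary: "\<And>Q. primeideal Q R \<Longrightarrow> I \<subseteq> Q \<Longrightarrow> Q = M"
    and dim: "krull_dim R = enat (length xs)"
begin

lemma parameter_ideal: "ideal I R" "I \<subseteq> M"
proof -
  have "set xs \<subseteq> carrier R" using xs ideal.Icarr[OF M_ideal] by blast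
  then show "ideal I R" "I \<subseteq> M"
    unfolding I_def using genideal_ideal genideal_minimal[OF M_ideal xs] by auto
qed

lemma xs_carrier: "set xs \<subseteq> carrier R"
  using xs ideal.Icarr[OF M_ideal] by blast

lemma reduction_of_parameter_ideal:
  assumes "is_reduction R J I"
  shows "J = I"
proof (rule ccontr)
  assume "J \<noteq> I"
  then obtain n where J: "ideal J R" "J \<subset> I"
    and n: "J \<cdot> (I [^]\<^bsub>ideals_set R\<^esub> n) = I [^]\<^bsub>ideals_set R\<^esub> Suc n"
    using assms unfolding is_reduction_def by auto
  obtain ys x where ys: "length xs = Suc (length ys)" "set ys \<subseteq> I" "x \<in> I"
    "\<forall>T. ideal T R \<longrightarrow> M \<cdot> I \<subseteq> T \<longrightarrow> set ys \<subseteq> T \<longrightarrow> J \<subseteq> T \<and> I \<subseteq> T <+> PIdl x"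
    using hyperplane_generators[OF xs_carrier I_def J] .
  obtain P where P: "minimal_prime R P" "prime_chain M (length xs) P"
    "\<not> prime_chain M (Suc (length xs)) P"
    using longest_prime_chain[OF dim M_prime primeideal_subset] .
  have pP: "primeideal P R" using P(1) unfolding minimal_prime_def by blast
  \<comment> \<open>For ordinary reductions the element to be avoided is simply
    \<open>\<one>\<close>.\<close>
  have "\<one> \<in> carrier R" "\<one> \<notin> P" using primeideal_one[OF pP] by auto
  from one_dimensional_reduction[OF parameter_ideal primary ys(4,2,3) pP P(2,3)[unfolded ys(1)] this]
  obtain Q where Q: "primeideal Q R" "Q \<subset> M" "x \<notin> Q" "I \<subseteq> Q <+> PIdl x"
    "\<forall>j\<in>J. \<exists>r\<in>Q. \<exists>a\<in>M. j = r \<oplus> a \<otimes> x"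
    by metis
  have iQ: "ideal Q R" using Q(1) by (rule primeideal_ideal)
  have xc: "x \<in> carrier R" using ys(3) ideal.Icarr[OF parameter_ideal(1)] by blast
  define y where "y = x [^] n"
  have yc: "y \<in> carrier R" using xc by (simp add: y_def)
  \<comment> \<open>Modulo \<open>Q\<close>, \<open>J\<close> lies in \<open>M x\<close> and the
    \<open>n\<close>-th power of \<open>I\<close> in \<open>(y)\<close>, so the product lies in
    \<open>M y x\<close>. It also contains \<open>y \<otimes> x\<close>, the power of
    \<open>x\<close> with exponent \<open>n + 1\<close>.\<close>
  have "\<exists>r\<in>Q. \<exists>a\<in>M. w = r \<oplus> a \<otimes> (y \<otimes> x)" if "w \<in> J \<cdot> (I [^]\<^bsub>ideals_set R\<^esub> n)" for w
    using that
  proof (induction w rule: ideal_prod.induct)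
    case (prod i j)
    have "j \<in> Q <+> PIdl y"
      using ideals_pow_subset[OF iQ xc Q(4), of n] prod(2) unfolding y_def by blast
    then obtain s b where s: "s \<in> Q" "b \<in> carrier R" "j = s \<oplus> b \<otimes> y" unfolding mem_add_PIdl by blast
    obtain r a where r: "r \<in> Q" "a \<in> M" "i = r \<oplus> a \<otimes> x" using Q(5) prod(1) by blast
    have c: "s \<in> carrier R" "r \<in> carrier R" "a \<in> carrier R"
      using s r ideal.Icarr[OF iQ] ideal.Icarr[OF M_ideal] by auto
    have "i \<otimes> j = ((s \<oplus> b \<otimes> y) \<otimes> r \<oplus> (a \<otimes> x) \<otimes> s) \<oplus> (b \<otimes> a) \<otimes> (y \<otimes> x)"
      unfolding r(3) s(3) using c s(2) xc yc by algebra
    moreover have "(s \<oplus> b \<otimes> y) \<otimes> r \<oplus> (a \<otimes> x) \<otimes> s \<in> Q"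
      using c r s xc yc by (intro ideal_add[OF iQ]) (simp_all add: ideal.I_l_closed[OF iQ])
    ultimately show ?case using ideal.I_l_closed[OF M_ideal r(2) s(2)] by blast
  next
    case (sum s1 s2)
    then obtain r1 a1 r2 a2 where s: "r1 \<in> Q" "a1 \<in> M" "s1 = r1 \<oplus> a1 \<otimes> (y \<otimes> x)"
      "r2 \<in> Q" "a2 \<in> M" "s2 = r2 \<oplus> a2 \<otimes> (y \<otimes> x)" by blast
    have "r1 \<in> carrier R" "a1 \<in> carrier R" "r2 \<in> carrier R" "a2 \<in> carrier R"
      using s ideal.Icarr[OF M_ideal] ideal.Icarr[OF iQ] by auto
    then have "s1 \<oplus> s2 = (r1 \<oplus> r2) \<oplus> (a1 \<oplus> a2) \<otimes> (y \<otimes> x)" unfolding s(3,6) using xc yc by algebra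
    then show ?case using ideal_add[OF iQ s(1,4)] ideal_add[OF M_ideal s(2,5)] by blast
  qed
  moreover have "y \<otimes> x \<in> J \<cdot> (I [^]\<^bsub>ideals_set R\<^esub> n)"
    using pow_in_ideals_pow[OF ys(3), of "Suc n"] unfolding n y_def by simp
  ultimately obtain r a where r: "r \<in> Q" "a \<in> M" "y \<otimes> x = r \<oplus> a \<otimes> (y \<otimes> x)" by blast
  have c: "r \<in> carrier R" "a \<in> carrier R" using r ideal.Icarr[OF iQ] ideal.Icarr[OF M_ideal] by auto
  \<comment> \<open>Cancelling \<open>y \<otimes> x\<close> modulo \<open>Q\<close> puts
    \<open>\<one> \<ominus> a\<close> into \<open>Q \<subset> M\<close>, although
    \<open>a \<in> M\<close>.\<close>
  have "(y \<otimes> x) \<otimes> (\<one> \<ominus> a) = y \<otimes> x \<ominus> a \<otimes> (y \<otimes> x)" using c xc yc by algebra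
  also have "\<dots> = (r \<oplus> a \<otimes> (y \<otimes> x)) \<ominus> a \<otimes> (y \<otimes> x)" using r(3) by simp
  also have "\<dots> = r" using c xc yc by algebra
  finally have "(y \<otimes> x) \<otimes> (\<one> \<ominus> a) \<in> Q" using r(1) by simp
  moreover have "y \<otimes> x \<notin> Q"
    using primeideal_pow[OF Q(1) xc, of "Suc n"] Q(3) by (auto simp: y_def)
  ultimately have "\<one> \<ominus> a \<in> Q"
    using primeideal.I_prime[OF Q(1), of "y \<otimes> x" "\<one> \<ominus> a"] c xc yc by auto
  then have "\<one> \<in> M" using ideal_minus_imp_add[OF M_ideal, of \<one> a] r(2) Q(2) by blast
  then show False using primeideal_one[OF M_prime] by blast
qed

lemma star_reduction_of_parameter_ideal:
  assumes p: "2 \<le> p" and star: "is_star_reduction R p J I"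
  shows "J = I"
proof (rule ccontr)
  assume "J \<noteq> I"
  then have J: "ideal J R" "J \<subset> I" and IJ: "I \<subseteq> tight_closure R p J"
    using star unfolding is_star_reduction_def by auto
  obtain ys x where ys: "length xs = Suc (length ys)" "set ys \<subseteq> I" "x \<in> I"
    "\<forall>T. ideal T R \<longrightarrow> M \<cdot> I \<subseteq> T \<longrightarrow> set ys \<subseteq> T \<longrightarrow> J \<subseteq> T \<and> I \<subseteq> T <+> PIdl x"
    using hyperplane_generators[OF xs_carrier I_def J] .
  obtain P where P: "minimal_prime R P" "prime_chain M (length xs) P"
    "\<not> prime_chain M (Suc (length xs)) P"
    using longest_prime_chain[OF dim M_prime primeideal_subset] .
  have pP: "primeideal P R" using P(1) unfolding minimal_prime_def by blast
  have xc: "x \<in> carrier R" using ys(3) ideal.Icarr[OF parameter_ideal(1)] by blast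
  have "x \<in> tight_closure R p J" using IJ ys(3) by blast
  then obtain d e0 where d: "d \<in> outside_minimal_primes R"
    "\<forall>e\<ge>e0. d \<otimes> x [^] (p ^ e) \<in> frobenius_power R J (p ^ e)"
    unfolding tight_closure_def by blast
  have dP: "d \<in> carrier R" "d \<notin> P" using d(1) P(1) unfolding outside_minimal_primes_def by auto
  have "P \<subset> M" using prime_chain_psubset P(2) unfolding ys(1) by blast
  then obtain t where t: "t \<in> M" "t \<notin> P" by blast
  have tc: "t \<in> carrier R" using t ideal.Icarr[OF M_ideal] by blast
  \<comment> \<open>The multiplier \<open>d\<close> may be a unit; the factor \<open>t\<close> puts
    \<open>c\<close> into \<open>M\<close> and keeps it outside \<open>P\<close>.\<close>
  define c where "c = t \<otimes> d"
  have c: "c \<in> carrier R" "c \<notin> P"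
    using primeideal_mult_notin[OF pP, of t d] tc t dP by (auto simp: c_def)
  have cM: "c \<in> M" unfolding c_def using ideal.I_r_closed[OF M_ideal t(1) dP(1)] .
  from one_dimensional_reduction[OF parameter_ideal primary ys(4,2,3) pP P(2,3)[unfolded ys(1)] c]
  obtain Q where Q: "primeideal Q R" "Q \<subset> M" "c \<notin> Q" "x \<notin> Q"
    "\<forall>T. primeideal T R \<longrightarrow> Q \<subset> T \<longrightarrow> T = M" "\<forall>j\<in>J. \<exists>r\<in>Q. \<exists>a\<in>M. j = r \<oplus> a \<otimes> x"
    by metis
  have iQ: "ideal Q R" using Q(1) by (rule primeideal_ideal)
  \<comment> \<open>As \<open>c \<notin> Q\<close>, a prime over this ideal lies strictly above
    \<open>Q\<close>, hence is \<open>M\<close>. So a fixed power of every element of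
    \<open>M\<close> falls into it. The square leaves one factor \<open>c\<close> over at the
    end.\<close>
  let ?C = "Q <+> PIdl (c \<otimes> c)"
  have cc: "c \<otimes> c \<in> carrier R" using c by simp
  have iC: "ideal ?C R" using ideal_add_PIdl[OF iQ cc] .
  obtain Ps and k :: nat where Ps: "finite Ps" "\<forall>T\<in>Ps. primeideal T R \<and> ?C \<subseteq> T"
    "\<forall>T. primeideal T R \<longrightarrow> ?C \<subseteq> T \<longrightarrow> (\<exists>T'\<in>Ps. T' \<subseteq> T)"
    "\<forall>a\<in>carrier R. (\<forall>T\<in>Ps. a \<in> T) \<longrightarrow> a [^] k \<in> ?C"
    using finite_primes_over[OF iC] .
  have "T = M" if "T \<in> Ps" for T
  proof -
    have T: "primeideal T R" "?C \<subseteq> T" using Ps(2) that by auto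
    then have "c \<otimes> c \<in> T" "Q \<subseteq> T" using add_PIdl_self[OF iQ cc] add_PIdl_upper[OF iQ cc] by auto
    then have "c \<in> T" using primeideal.I_prime[OF T(1) c(1) c(1)] by blast
    then show ?thesis using Q(3,5) T(1) \<open>Q \<subseteq> T\<close> by blast
  qed
  then have Mk: "a [^] k \<in> ?C" if "a \<in> M" for a
    using Ps(4) that ideal.Icarr[OF M_ideal] by blast
  \<comment> \<open>Large enough both for the tight closure condition and, because
    \<open>p \<ge> 2\<close>, for \<open>k \<le> p ^ e\<close>.\<close>
  define e where "e = max e0 k"
  define q where "q = p ^ e"
  have "k \<le> q"
  proof -
    have "k < 2 ^ k" by (rule less_exp)
    also have "\<dots> \<le> 2 ^ e" by (intro power_increasing) (auto simp: e_def)
    also have "\<dots> \<le> q" unfolding q_def using p by (intro power_mono) auto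
    finally show ?thesis by simp
  qed
  have Mq: "a [^] q \<in> ?C" if "a \<in> M" for a
  proof -
    have ac: "a \<in> carrier R" using that ideal.Icarr[OF M_ideal] by blast
    have "a [^] q = a [^] (q - k) \<otimes> a [^] k" using \<open>k \<le> q\<close> ac by (simp add: nat_pow_mult)
    then show ?thesis using ideal.I_l_closed[OF iC Mk[OF that], of "a [^] (q - k)"] ac by simp
  qed
  define y where "y = x [^] q"
  have yc: "y \<in> carrier R" using xc by (simp add: y_def)
  \<comment> \<open>For \<open>j\<close> congruent to \<open>a \<otimes> x\<close> modulo
    \<open>Q\<close> with \<open>a \<in> M\<close>, the power \<open>j [^] q\<close> is congruent to
    \<open>a [^] q \<otimes> y\<close>, and \<open>a [^] q\<close> lies in
    \<open>?C\<close>.\<close>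
  let ?W = "Q <+> PIdl ((c \<otimes> c) \<otimes> y)"
  have iW: "ideal ?W R" using ideal_add_PIdl[OF iQ] cc yc by simp
  have "frobenius_power R J q \<subseteq> ?W"
    unfolding frobenius_power_def
  proof (rule genideal_minimal[OF iW], rule image_subsetI)
    fix j assume "j \<in> J"
    then obtain r a where r: "r \<in> Q" "a \<in> M" "j = r \<oplus> a \<otimes> x" using Q(6) by blast
    have ac: "a \<in> carrier R" using r ideal.Icarr[OF M_ideal] by blast
    have rc: "r \<in> carrier R" using r ideal.Icarr[OF iQ] by blast
    define z where "z = j [^] q \<ominus> (a \<otimes> x) [^] q"
    have z: "z \<in> Q" unfolding z_def r(3) using pow_cong_mod_ideal[OF iQ r(1)] ac xc by simp
    obtain s b where s: "s \<in> Q" "b \<in> carrier R" "a [^] q = s \<oplus> b \<otimes> (c \<otimes> c)"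
      using Mq[OF r(2)] unfolding mem_add_PIdl by blast
    have sc: "s \<in> carrier R" "z \<in> carrier R" using s z ideal.Icarr[OF iQ] by auto
    have "j [^] q = z \<oplus> (a \<otimes> x) [^] q"
    proof -
      have "j [^] q \<in> carrier R" "(a \<otimes> x) [^] q \<in> carrier R" using ac xc rc r(3) by auto
      then show ?thesis unfolding z_def by algebra
    qed
    also have "(a \<otimes> x) [^] q = a [^] q \<otimes> y" using ac xc by (simp add: nat_pow_distrib y_def)
    also have "z \<oplus> a [^] q \<otimes> y = (z \<oplus> y \<otimes> s) \<oplus> b \<otimes> ((c \<otimes> c) \<otimes> y)"
      unfolding s(3) using sc s(2) c(1) yc by algebra
    finally have "j [^] q = (z \<oplus> y \<otimes> s) \<oplus> b \<otimes> ((c \<otimes> c) \<otimes> y)" .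
    moreover have "z \<oplus> y \<otimes> s \<in> Q"
      using ideal_add[OF iQ z ideal.I_l_closed[OF iQ s(1) yc]] .
    ultimately show "j [^] q \<in> ?W" unfolding mem_add_PIdl using s(2) by blast
  qed
  moreover have "d \<otimes> y \<in> frobenius_power R J q"
    using d(2) unfolding y_def q_def e_def by simp
  ultimately have "d \<otimes> y \<in> ?W" by blast
  then have "t \<otimes> (d \<otimes> y) \<in> ?W" using ideal.I_l_closed[OF iW _ tc] by blast
  then obtain r b where r: "r \<in> Q" "b \<in> carrier R" "t \<otimes> (d \<otimes> y) = r \<oplus> b \<otimes> ((c \<otimes> c) \<otimes> y)"
    unfolding mem_add_PIdl by blast
  have rc: "r \<in> carrier R" using r ideal.Icarr[OF iQ] by blast
  \<comment> \<open>Cancelling \<open>y \<otimes> c\<close>, which is nonzero modulo the prime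
    \<open>Q\<close>, leaves \<open>\<one> \<ominus> b \<otimes> c\<close> in
    \<open>Q \<subset> M\<close>, although \<open>c \<in> M\<close>.\<close>
  have "(y \<otimes> c) \<otimes> (\<one> \<ominus> b \<otimes> c) = c \<otimes> y \<ominus> b \<otimes> ((c \<otimes> c) \<otimes> y)" using c(1) yc r(2) by algebra
  also have "c \<otimes> y = r \<oplus> b \<otimes> ((c \<otimes> c) \<otimes> y)"
    using r(3) tc dP(1) yc by (simp add: c_def m_assoc)
  also have "r \<oplus> b \<otimes> ((c \<otimes> c) \<otimes> y) \<ominus> b \<otimes> ((c \<otimes> c) \<otimes> y) = r" using c(1) yc r(2) rc by algebra
  finally have "(y \<otimes> c) \<otimes> (\<one> \<ominus> b \<otimes> c) \<in> Q" using r(1) by simp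
  moreover have "y \<otimes> c \<notin> Q"
    using primeideal_mult_notin[OF Q(1), of y c] primeideal_pow[OF Q(1) xc, of q] Q(3,4) c(1) yc
    by (auto simp: y_def)
  ultimately have "\<one> \<ominus> b \<otimes> c \<in> Q"
    using primeideal.I_prime[OF Q(1), of "y \<otimes> c" "\<one> \<ominus> b \<otimes> c"] c(1) yc r(2) by auto
  moreover have "b \<otimes> c \<in> M" using ideal.I_l_closed[OF M_ideal cM r(2)] .
  ultimately have "\<one> \<in> M" using ideal_minus_imp_add[OF M_ideal, of \<one> "b \<otimes> c"] Q(2) by blast
  then show False using primeideal_one[OF M_prime] by blast
qed

end

end

theorem proposition4p1:
  fixes R :: "('a, 'b) ring_scheme" and p :: nat and xs :: "'a list" and I :: "'a set"
  assumes "noetherian_ring R"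
    and "local_ring R"
    and "Factorial_Ring.prime p"
    and "ring_characteristic R = p"
    and "system_of_parameters R xs"
    and "I = Idl\<^bsub>R\<^esub> (set xs)"
  shows "star_core R p I = core R I"
proof -
  have unique: "\<exists>!M. maximalideal M R"
    using assms(2) by (rule local_ring.ex1_maximalideal)
  interpret noetherian_cring R
    using assms(1) local_ring.axioms(1)[OF assms(2)] by (rule noetherian_cring.intro)
  have max: "maximalideal (max_ideal R) R"
    unfolding max_ideal_def using unique by (rule theI')
  then have uniq: "N = max_ideal R" if "maximalideal N R" for N
    using that unique by blast
  interpret noetherian_local_ring R "max_ideal R"
    by (rule noetherian_local_ring.intro[OF noetherian_cring_axioms
          noetherian_local_ring_axioms.intro[OF max uniq]])
  have sop: "set xs \<subseteq> max_ideal R" "krull_dim R = enat (length xs)"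
    and rad: "ideal_radical R I = max_ideal R"
    using assms(5,6) unfolding system_of_parameters_def by auto
  \<comment> \<open>A prime over \<open>I\<close> contains the radical of \<open>I\<close>, which is
    the maximal ideal.\<close>
  have primary: "Q = max_ideal R" if Q: "primeideal Q R" "I \<subseteq> Q" for Q
  proof
    show "Q \<subseteq> max_ideal R" using primeideal_subset[OF Q(1)] .
    show "max_ideal R \<subseteq> Q"
      using primeideal_pow[OF Q(1)] Q(2) unfolding rad[symmetric] ideal_radical_def by blast
  qed
  note params = sop(1) assms(6) primary sop(2)
  have I: "ideal I R" using parameter_ideal(1)[OF params] .
  \<comment> \<open>Both cores are intersections of the one-element family containing
    \<open>I\<close>.\<close>
  have "{J. is_star_reduction R p J I} = {I}"
    using star_reduction_of_parameter_ideal[OF params prime_ge_2_nat[OF assms(3)]]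
      is_star_reduction_refl[OF I] by blast
  moreover have "{J. is_reduction R J I} = {I}"
    using reduction_of_parameter_ideal[OF params] is_reduction_refl[OF I] by blast
  ultimately show ?thesis unfolding star_core_def core_def by simp
qed

end
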